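(* Let $T=T_1e_1+T_2e_2+T_3e_3\in\mathcal{BC}(X)$ and assume that the operators $T_\ell$, $\ell=1,2,3$, have real spectrum. Let $\sigma_S(T)=\sigma_1\cup\sigma_2$ with $\operatorname{dist}(\sigma_1,\sigma_2)>0$, and let $G_1,G_2\subset\mathbb H$ be bounded slice Cauchy domains such that $\sigma_1\subset G_1$, $\overline{G_1}\subset G_2$ and $\operatorname{dist}(G_2,\sigma_2)>0$. Let $J\in\mathbb S$. Then $$\tilde P:=\frac1{2\pi}\int_{\partial(G_2\cap\mathbb C_J)}s\,ds_J\,\mathcal Q_{c,s}(T)^{-1}=\frac1{2\pi}\int_{\partial(G_1\cap\mathbb C_J)}\mathcal Q_{c,p}(T)^{-1}\,dp_J\,p$$ is a projection, $\tilde P^2=\tilde P$, and $T\tilde P=\tilde PT$.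
   Context: $\mathbb H$ denotes the quaternions with units $e_1,e_2,e_3$; $\mathbb S$ is the sphere of unit purely imaginary quaternions and $\mathbb C_J=\{u+Jv:u,v\in\mathbb R\}$. $X=X_{\mathbb R}\otimes\mathbb H$ is a two-sided quaternionic Banach module over a real Banach space $X_{\mathbb R}$; $\mathcal{BC}(X)$ is the set of $T=T_0+T_1e_1+T_2e_2+T_3e_3$ with $T_i\in\mathcal B(X_{\mathbb R})$ pairwise commuting; $\bar T=T_0-\sum T_ie_i$; $\mathcal Q_{c,s}(T)=s^2\mathcal I-s(T+\bar T)+T\bar T$. The $S$-spectrum $\sigma_S(T)$ is the set of $s$ for which $\mathcal Q_{c,s}(T)$ has no bounded inverse. A set is axially symmetric if with $u+Iv$ it contains all $u+Jv$, $J\in\mathbb S$; a slice Cauchy domain is an axially symmetric open set $U$ such that for each $J$ the boundary of $U\cap\mathbb C_J$ is a finite union of nonintersecting piecewise $C^1$ Jordan curves. Integrals are over positively oriented boundaries with $ds_J=ds(-J)$. *)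

theory Defs
  imports "HOL-Complex_Analysis.Complex_Analysis"
begin

text \<open>Quaternions are represented as 4-tuples (q0,q1,q2,q3) = q0 + q1 e1 + q2 e2 + q3 e3;
  the product norm on nested pairs is the Euclidean norm of R^4.\<close>

type_synonym quat = "real \<times> real \<times> real \<times> real"

text \<open>Elements x0 + x1 e1 + x2 e2 + x3 e3 of X = X_R (x) H, with x_i in X_R.\<close>
type_synonym 'x qmod = "'x \<times> 'x \<times> 'x \<times> 'x"

definition c0 :: "'a \<times> 'a \<times> 'a \<times> 'a \<Rightarrow> 'a" where "c0 x = fst x"
definition c1 :: "'a \<times> 'a \<times> 'a \<times> 'a \<Rightarrow> 'a" where "c1 x = fst (snd x)"
definition c2 :: "'a \<times> 'a \<times> 'a \<times> 'a \<Rightarrow> 'a" where "c2 x = fst (snd (snd x))"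
definition c3 :: "'a \<times> 'a \<times> 'a \<times> 'a \<Rightarrow> 'a" where "c3 x = snd (snd (snd x))"

text \<open>Quaternion product (Hamilton rules e1^2=e2^2=e3^2=e1e2e3=-1).\<close>
definition qmult :: "quat \<Rightarrow> quat \<Rightarrow> quat" (infixl "\<star>" 70) where
  "p \<star> q =
    (c0 p * c0 q - c1 p * c1 q - c2 p * c2 q - c3 p * c3 q,
     c0 p * c1 q + c1 p * c0 q + c2 p * c3 q - c3 p * c2 q,
     c0 p * c2 q - c1 p * c3 q + c2 p * c0 q + c3 p * c1 q,
     c0 p * c3 q + c1 p * c2 q - c2 p * c1 q + c3 p * c0 q)"

definition SS :: "quat set" where
  "SS = {q. c0 q = 0 \<and> (c1 q)\<^sup>2 + (c2 q)\<^sup>2 + (c3 q)\<^sup>2 = 1}"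

definition sliceJ :: "quat \<Rightarrow> complex \<Rightarrow> quat" where
  "sliceJ J z = (Re z, 0, 0, 0) + Im z *\<^sub>R J"

text \<open>The operator A0 + A1 e1 + A2 e2 + A3 e3 (A_i in B(X_R)) acting on X by
  (sum A_i e_i)(sum x_j e_j) = sum A_i(x_j) e_i e_j.\<close>
definition qop_fun :: "('x::real_normed_vector \<Rightarrow>\<^sub>L 'x) qmod \<Rightarrow> 'x qmod \<Rightarrow> 'x qmod" where
  "qop_fun A x =
    (c0 A (c0 x) - c1 A (c1 x) - c2 A (c2 x) - c3 A (c3 x),
     c0 A (c1 x) + c1 A (c0 x) + c2 A (c3 x) - c3 A (c2 x),
     c0 A (c2 x) - c1 A (c3 x) + c2 A (c0 x) + c3 A (c1 x),
     c0 A (c3 x) + c1 A (c2 x) - c2 A (c1 x) + c3 A (c0 x))"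

lemma bounded_linear_qop_fun: "bounded_linear (qop_fun (A :: ('x::real_normed_vector \<Rightarrow>\<^sub>L 'x) qmod))"
proof -
  have p: "bounded_linear (c0 :: 'x qmod \<Rightarrow> 'x)" "bounded_linear (c1 :: 'x qmod \<Rightarrow> 'x)"
          "bounded_linear (c2 :: 'x qmod \<Rightarrow> 'x)" "bounded_linear (c3 :: 'x qmod \<Rightarrow> 'x)"
    unfolding c0_def[abs_def] c1_def[abs_def] c2_def[abs_def] c3_def[abs_def]
    by (auto intro!: bounded_linear_compose[OF bounded_linear_fst]
                     bounded_linear_compose[OF bounded_linear_snd] bounded_linear_fst bounded_linear_snd)
  have a: "\<And>B c. bounded_linear c \<Longrightarrow> bounded_linear (\<lambda>x. blinfun_apply B (c x))"
    by (rule bounded_linear_compose[OF blinfun.bounded_linear_right])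
  show ?thesis
    unfolding qop_fun_def
    by (intro bounded_linear_Pair bounded_linear_add bounded_linear_sub a p)
qed

definition qop :: "('x::real_normed_vector \<Rightarrow>\<^sub>L 'x) qmod \<Rightarrow> ('x qmod \<Rightarrow>\<^sub>L 'x qmod)" where
  "qop A = Blinfun (qop_fun A)"

lemma qop_apply: "blinfun_apply (qop A) = qop_fun A"
  unfolding qop_def by (rule bounded_linear_Blinfun_apply[OF bounded_linear_qop_fun])

definition qscal :: "quat \<Rightarrow> ('x::real_normed_vector qmod \<Rightarrow>\<^sub>L 'x qmod)" where
  "qscal q = qop (c0 q *\<^sub>R id_blinfun, c1 q *\<^sub>R id_blinfun, c2 q *\<^sub>R id_blinfun, c3 q *\<^sub>R id_blinfun)"

definition qconjop :: "('x::real_normed_vector \<Rightarrow>\<^sub>L 'x) qmod \<Rightarrow> ('x \<Rightarrow>\<^sub>L 'x) qmod" where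
  "qconjop A = (c0 A, - c1 A, - c2 A, - c3 A)"

definition Qcs :: "('x::real_normed_vector \<Rightarrow>\<^sub>L 'x) qmod \<Rightarrow> quat \<Rightarrow> ('x qmod \<Rightarrow>\<^sub>L 'x qmod)" where
  "Qcs T s = qscal (s \<star> s) - (qscal s o\<^sub>L (qop T + qop (qconjop T))) + (qop T o\<^sub>L qop (qconjop T))"

definition has_bounded_inverse :: "('a::real_normed_vector \<Rightarrow>\<^sub>L 'a) \<Rightarrow> bool" where
  "has_bounded_inverse A \<longleftrightarrow> (\<exists>B. B o\<^sub>L A = id_blinfun \<and> A o\<^sub>L B = id_blinfun)"

definition binv :: "('a::real_normed_vector \<Rightarrow>\<^sub>L 'a) \<Rightarrow> ('a \<Rightarrow>\<^sub>L 'a)" where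
  "binv A = (SOME B. B o\<^sub>L A = id_blinfun \<and> A o\<^sub>L B = id_blinfun)"

definition S_spectrum :: "('x::real_normed_vector \<Rightarrow>\<^sub>L 'x) qmod \<Rightarrow> quat set" where
  "S_spectrum T = {s. \<not> has_bounded_inverse (Qcs T s)}"

text \<open>A_C - lambda on the complexification X_R + i X_R, written on pairs (x,y) = x + iy.\<close>
definition cshift_fun :: "('x::real_normed_vector \<Rightarrow>\<^sub>L 'x) \<Rightarrow> complex \<Rightarrow> 'x \<times> 'x \<Rightarrow> 'x \<times> 'x" where
  "cshift_fun A l p = (A (fst p) - Re l *\<^sub>R fst p + Im l *\<^sub>R snd p,
                       A (snd p) - Im l *\<^sub>R fst p - Re l *\<^sub>R snd p)"

lemma bounded_linear_cshift_fun: "bounded_linear (cshift_fun A l)"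
proof -
  have a: "\<And>B c. bounded_linear c \<Longrightarrow> bounded_linear (\<lambda>x. blinfun_apply B (c x))"
    by (rule bounded_linear_compose[OF blinfun.bounded_linear_right])
  have s: "\<And>r c. bounded_linear c \<Longrightarrow> bounded_linear (\<lambda>x. r *\<^sub>R c x)"
    by (rule bounded_linear_compose[OF bounded_linear_scaleR_right])
  show ?thesis unfolding cshift_fun_def
    by (intro bounded_linear_Pair bounded_linear_add bounded_linear_sub a s
        bounded_linear_fst bounded_linear_snd)
qed

definition cshift :: "('x::real_normed_vector \<Rightarrow>\<^sub>L 'x) \<Rightarrow> complex \<Rightarrow> (('x \<times> 'x) \<Rightarrow>\<^sub>L ('x \<times> 'x))" where
  "cshift A l = Blinfun (cshift_fun A l)"

definition cspectrum :: "('x::real_normed_vector \<Rightarrow>\<^sub>L 'x) \<Rightarrow> complex set" where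
  "cspectrum A = {l. \<not> has_bounded_inverse (cshift A l)}"

definition axially_symmetric :: "quat set \<Rightarrow> bool" where
  "axially_symmetric U \<longleftrightarrow>
     (\<forall>u v I J. I \<in> SS \<longrightarrow> J \<in> SS \<longrightarrow> sliceJ I (Complex u v) \<in> U \<longrightarrow> sliceJ J (Complex u v) \<in> U)"

definition slice_part :: "quat set \<Rightarrow> quat \<Rightarrow> complex set" where
  "slice_part U J = {z. sliceJ J z \<in> U}"

definition jordan_family :: "(real \<Rightarrow> complex) list \<Rightarrow> bool" where
  "jordan_family \<gamma>s \<longleftrightarrow>
     (\<forall>\<gamma>\<in>set \<gamma>s. valid_path \<gamma> \<and> simple_path \<gamma> \<and> pathfinish \<gamma> = pathstart \<gamma>) \<and>
     distinct \<gamma>s \<and>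
     (\<forall>\<gamma>\<in>set \<gamma>s. \<forall>\<eta>\<in>set \<gamma>s. \<gamma> \<noteq> \<eta> \<longrightarrow> path_image \<gamma> \<inter> path_image \<eta> = {})"

definition slice_cauchy_domain :: "quat set \<Rightarrow> bool" where
  "slice_cauchy_domain U \<longleftrightarrow> open U \<and> axially_symmetric U \<and>
     (\<forall>J\<in>SS. \<exists>\<gamma>s. jordan_family \<gamma>s \<and>
        frontier (slice_part U J) = (\<Union>\<gamma>\<in>set \<gamma>s. path_image \<gamma>))"

text \<open>gs parametrizes the boundary of the (bounded) planar open set V with positive
  orientation: the curves exhaust the boundary and V lies to their left, i.e. the total
  winding number is 1 on V and 0 off the closure of V.\<close>
definition pos_oriented_boundary :: "complex set \<Rightarrow> (real \<Rightarrow> complex) list \<Rightarrow> bool" where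
  "pos_oriented_boundary V \<gamma>s \<longleftrightarrow> jordan_family \<gamma>s \<and>
     frontier V = (\<Union>\<gamma>\<in>set \<gamma>s. path_image \<gamma>) \<and>
     (\<forall>z\<in>V. (\<Sum>\<gamma>\<leftarrow>\<gamma>s. winding_number \<gamma> z) = 1) \<and>
     (\<forall>z. z \<notin> closure V \<longrightarrow> (\<Sum>\<gamma>\<leftarrow>\<gamma>s. winding_number \<gamma> z) = 0)"

text \<open>For a path g in C (parametrizing a curve in C_J via sliceJ), the integrand of
  the integral of G(s, ds_J), where s = sliceJ J (g t) and ds_J = ds (-J) with
  ds = sliceJ J (g'(t)) dt.\<close>
definition qpath_integrand ::
  "quat \<Rightarrow> (quat \<Rightarrow> quat \<Rightarrow> 'b) \<Rightarrow> (real \<Rightarrow> complex) \<Rightarrow> real \<Rightarrow> 'b" where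
  "qpath_integrand J G \<gamma> t =
     G (sliceJ J (\<gamma> t)) (sliceJ J (vector_derivative \<gamma> (at t within {0..1})) \<star> (- J))"

definition qpath_integrable ::
  "quat \<Rightarrow> (quat \<Rightarrow> quat \<Rightarrow> 'b::real_normed_vector) \<Rightarrow> (real \<Rightarrow> complex) list \<Rightarrow> bool" where
  "qpath_integrable J G \<gamma>s \<longleftrightarrow> (\<forall>\<gamma>\<in>set \<gamma>s. qpath_integrand J G \<gamma> integrable_on {0..1})"

definition qpath_integral ::
  "quat \<Rightarrow> (quat \<Rightarrow> quat \<Rightarrow> 'b::real_normed_vector) \<Rightarrow> (real \<Rightarrow> complex) list \<Rightarrow> 'b" where
  "qpath_integral J G \<gamma>s = (\<Sum>\<gamma>\<leftarrow>\<gamma>s. integral {0..1} (qpath_integrand J G \<gamma>))"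

end

theory Submission
  imports Defs
begin

text \<open>
  Since \<open>T\<^sub>0 = 0\<close>, \<open>Q\<^sub>s = s\<^sup>2 + D\<close> with \<open>D = T\<^sub>1\<^sup>2 + T\<^sub>2\<^sup>2 + T\<^sub>3\<^sup>2\<close> acting componentwise, and left
  multiplication by \<open>J\<close> is a complex structure commuting with \<open>D\<close>; so \<open>P\<close> is the integral of
  \<open>z (z\<^sup>2 + D)\<^sup>-\<^sup>1 / (2 \<pi> \<i>)\<close>. As the \<open>T\<^sub>l\<close> have real spectrum and commute, \<open>D\<close> has nonnegative
  spectrum, and the singular set \<open>K\<close> of the integrand lies on the imaginary axis, where conjugation
  is \<open>z \<mapsto> - z\<close>. The complement of \<open>K\<close> is therefore connected, so a cycle can be
  joined to a single loop and Cauchy's theorem shows that \<open>P\<close> depends only on winding numbers about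
  \<open>K\<close>. Splitting an operator that commutes with \<open>D\<close> into its \<open>J\<close>-linear and \<open>J\<close>-antilinear parts,
  the second part being handled by the conjugate contour, it commutes with \<open>P\<close>. Finally
  \<open>(1 - P) (z\<^sup>2 + D)\<^sup>-\<^sup>1\<close> continues holomorphically across the part of \<open>K\<close> inside the contour,
  so \<open>(1 - P) P = 0\<close>. Operator-valued integrals are reduced to scalar ones by the Hahn-Banach theorem.
\<close>

section \<open>Norming functionals\<close>

text \<open>With \<open>w = z^2\<close> the integrand \<open>z (z^2 + D)^-1 dz\<close> is half of
  \<open>(w + D)^-1 dw\<close>, so \<open>P\<close> is half of the classical Riesz integral of
  \<open>- D\<close> along the squared contour. A nonzero point of the spectrum has the two roots
  \<open>z\<close> and \<open>- z\<close>, each contributing one half; at zero the squared contour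
  winds twice. The halves add up to a projection only because axial symmetry puts both roots on the
  same side of the contour. The obstacle to \<open>T P = P T\<close> is that \<open>T\<close>
  commutes with \<open>D\<close> but in general not with left multiplication by \<open>J\<close>,
  hence not with the complex scalars \<open>z\<close> and \<open>dz\<close> of the integral.
  Commutation therefore cannot be read off under the integral sign.\<close>

definition sublinear :: "('v::real_vector \<Rightarrow> real) \<Rightarrow> bool" where
  "sublinear p \<longleftrightarrow> (\<forall>x y. p (x + y) \<le> p x + p y) \<and> (\<forall>c x. 0 \<le> c \<longrightarrow> p (c *\<^sub>R x) = c * p x)"

lemma sublinear_minus: "sublinear p \<Longrightarrow> - p (- x) \<le> p x"
proof -
  assume p: "sublinear p"
  have "p (x + - x) \<le> p x + p (- x)" "p (0 *\<^sub>R x) = 0 * p x"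
    using p unfolding sublinear_def by (blast, force)
  then show ?thesis by simp
qed

text \<open>For sublinear \<open>p\<close> this is the largest sublinear function below
  \<open>p\<close> with value at most \<open>- p a\<close> at \<open>- a\<close>. A linear function
  below it is therefore at least \<open>p a\<close> at \<open>a\<close>, and being below
  \<open>p\<close> it equals \<open>p a\<close> there.\<close>

definition tilt :: "('v::real_vector \<Rightarrow> real) \<Rightarrow> 'v \<Rightarrow> 'v \<Rightarrow> real" where
  "tilt p a x = (INF t\<in>{0..}. p (x + t *\<^sub>R a) - t * p a)"

lemma tilt_le:
  assumes "sublinear p" "0 \<le> t"
  shows "tilt p a x \<le> p (x + t *\<^sub>R a) - t * p a"
proof -
  \<comment> \<open>A real infimum is a lower bound only for sets that are bounded below;
    \<open>- p (- x)\<close> bounds this one.\<close>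
  have "- p (- x) \<le> p (x + s *\<^sub>R a) - s * p a" if "0 \<le> s" for s
  proof -
    have "p (x + s *\<^sub>R a + - x) \<le> p (x + s *\<^sub>R a) + p (- x)" "p (s *\<^sub>R a) = s * p a"
      using assms that unfolding sublinear_def by (blast, force)
    then show ?thesis by simp
  qed
  then have "bdd_below ((\<lambda>s. p (x + s *\<^sub>R a) - s * p a) ` {0..})"
    by (intro bdd_belowI[where m = "- p (- x)"]) auto
  then show ?thesis unfolding tilt_def by (rule cINF_lower) (use assms in auto)
qed

lemma tilt_ge: "(\<And>t. 0 \<le> t \<Longrightarrow> m \<le> p (x + t *\<^sub>R a) - t * p a) \<Longrightarrow> m \<le> tilt p a x"
  unfolding tilt_def by (rule cINF_greatest) auto

lemma tilt_le_self: "sublinear p \<Longrightarrow> tilt p a x \<le> p x"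
  using tilt_le[of p 0] by simp

lemma sublinear_tilt:
  assumes p: "sublinear p"
  shows "sublinear (tilt p a)"
proof -
  have add: "tilt p a (x + y) \<le> tilt p a x + tilt p a y" for x y
  proof -
    have "tilt p a (x + y) \<le> (p (x + s *\<^sub>R a) - s * p a) + (p (y + t *\<^sub>R a) - t * p a)"
      if "0 \<le> s" "0 \<le> t" for s t
    proof -
      have "tilt p a (x + y) \<le> p (x + y + (s + t) *\<^sub>R a) - (s + t) * p a"
        by (rule tilt_le) (use p that in auto)
      also have "x + y + (s + t) *\<^sub>R a = (x + s *\<^sub>R a) + (y + t *\<^sub>R a)"
        by (simp add: algebra_simps)
      also have "p \<dots> \<le> p (x + s *\<^sub>R a) + p (y + t *\<^sub>R a)"
        using p unfolding sublinear_def by blast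
      finally show ?thesis by (simp add: algebra_simps)
    qed
    then have "tilt p a (x + y) - (p (x + s *\<^sub>R a) - s * p a) \<le> tilt p a y" if "0 \<le> s" for s
      using that by (intro tilt_ge) (force simp: diff_le_eq add.commute)
    then have "tilt p a (x + y) - tilt p a y \<le> tilt p a x"
      by (intro tilt_ge) (simp add: algebra_simps)
    then show ?thesis by simp
  qed
  have scale_le: "tilt p a (c *\<^sub>R x) \<le> c * tilt p a x" if c: "0 < c" for c x
  proof -
    have "inverse c * tilt p a (c *\<^sub>R x) \<le> p (x + t *\<^sub>R a) - t * p a" if "0 \<le> t" for t
    proof -
      have "tilt p a (c *\<^sub>R x) \<le> p (c *\<^sub>R x + (c * t) *\<^sub>R a) - (c * t) * p a"
        by (rule tilt_le) (use p c that in auto)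
      also have "c *\<^sub>R x + (c * t) *\<^sub>R a = c *\<^sub>R (x + t *\<^sub>R a)"
        by (simp add: algebra_simps)
      also have "p \<dots> = c * p (x + t *\<^sub>R a)"
        using p c unfolding sublinear_def by force
      finally show ?thesis using c by (simp add: field_simps)
    qed
    then have "inverse c * tilt p a (c *\<^sub>R x) \<le> tilt p a x"
      by (rule tilt_ge)
    then show ?thesis using c by (simp add: field_simps)
  qed
  have "tilt p a (c *\<^sub>R x) = c * tilt p a x" if "0 \<le> c" for c x
  proof (cases "c = 0")
    case True
    have "p (0 + t *\<^sub>R a) - t * p a = 0" if "0 \<le> t" for t
      using p that unfolding sublinear_def by force
    then have "tilt p a 0 = 0"
      using tilt_ge[of 0 p 0 a] tilt_le[OF p, of 0 a 0] by force
    with True show ?thesis by simp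
  next
    case False
    with that have c: "0 < c" by simp
    from scale_le[of "inverse c" "c *\<^sub>R x"] c have "c * tilt p a x \<le> tilt p a (c *\<^sub>R x)"
      by (simp add: field_simps)
    with scale_le[OF c] show ?thesis by (meson order_antisym)
  qed
  with add show ?thesis unfolding sublinear_def by blast
qed

text \<open>An infimum of sublinear functions need not be sublinear. In a chain the smaller of
  \<open>q\<close> and \<open>r\<close> serves both arguments of the subadditivity estimate, and the
  common majorant \<open>p\<close> supplies the lower bound \<open>- p (- x)\<close>.\<close>

lemma sublinear_INF_chain:
  assumes ne: "C \<noteq> {}" and sub: "\<And>q. q \<in> C \<Longrightarrow> sublinear q"
    and chain: "\<And>q r. q \<in> C \<Longrightarrow> r \<in> C \<Longrightarrow> (\<forall>x. q x \<le> r x) \<or> (\<forall>x. r x \<le> q x)"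
    and bound: "\<And>q x. q \<in> C \<Longrightarrow> q x \<le> p x"
  shows "sublinear (\<lambda>x. INF q\<in>C. q x)" and "\<And>q x. q \<in> C \<Longrightarrow> (INF q\<in>C. q x) \<le> q x"
proof -
  have bdd: "bdd_below ((\<lambda>q. q x) ` C)" for x
  proof (rule bdd_belowI2)
    fix q assume "q \<in> C"
    then show "- p (- x) \<le> q x" using sublinear_minus[OF sub, of q x] bound[of q "- x"] by simp
  qed
  show le: "(INF q\<in>C. q x) \<le> q x" if "q \<in> C" for q x
    by (rule cINF_lower[OF bdd that])
  have add: "(INF q\<in>C. q (x + y)) \<le> (INF q\<in>C. q x) + (INF q\<in>C. q y)" for x y
  proof -
    have main: "(INF q\<in>C. q (x + y)) \<le> q x + r y" if q: "q \<in> C" and r: "r \<in> C" for q r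
    proof -
      have "(INF q\<in>C. q (x + y)) \<le> q (x + y)" "(INF q\<in>C. q (x + y)) \<le> r (x + y)"
        using le q r by blast+
      moreover have "q (x + y) \<le> q x + q y" "r (x + y) \<le> r x + r y"
        using sub q r unfolding sublinear_def by blast+
      ultimately show ?thesis using chain[OF q r] by (smt (verit))
    qed
    have "(INF q\<in>C. q (x + y)) - q x \<le> (INF q\<in>C. q y)" if "q \<in> C" for q
      by (rule cINF_greatest[OF ne]) (use main[OF that] in force)
    then have "(INF q\<in>C. q (x + y)) - (INF q\<in>C. q y) \<le> (INF q\<in>C. q x)"
      by (intro cINF_greatest[OF ne]) force
    then show ?thesis by simp
  qed
  have scale_le: "(INF q\<in>C. q (c *\<^sub>R x)) \<le> c * (INF q\<in>C. q x)" if c: "0 < c" for c x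
  proof -
    have "inverse c * (INF q\<in>C. q (c *\<^sub>R x)) \<le> (INF q\<in>C. q x)"
    proof (rule cINF_greatest[OF ne])
      fix q assume q: "q \<in> C"
      have "q (c *\<^sub>R x) = c * q x" using sub[OF q] c unfolding sublinear_def by simp
      then show "inverse c * (INF q\<in>C. q (c *\<^sub>R x)) \<le> q x"
        using le[OF q, of "c *\<^sub>R x"] c by (simp add: field_simps)
    qed
    then show ?thesis using c by (simp add: field_simps)
  qed
  have scale: "(INF q\<in>C. q (c *\<^sub>R x)) = c * (INF q\<in>C. q x)" if "0 \<le> c" for c x
  proof (cases "c = 0")
    case True
    have "q (0 *\<^sub>R x) = 0" if "q \<in> C" for q
      using sub[OF that] unfolding sublinear_def by (metis mult_zero_left order_refl)
    then have "(\<lambda>q. q (0 *\<^sub>R x)) ` C = {0}" using ne by force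
    then show ?thesis using True by simp
  next
    case False
    with that have c: "0 < c" by simp
    from scale_le[of "inverse c" "c *\<^sub>R x"] c
    have "c * (INF q\<in>C. q x) \<le> (INF q\<in>C. q (c *\<^sub>R x))" by (simp add: field_simps)
    with scale_le[OF c] show ?thesis by (meson order_antisym)
  qed
  show "sublinear (\<lambda>x. INF q\<in>C. q x)"
    unfolding sublinear_def using add scale by blast
qed

text \<open>Minimal sublinear functions are linear, so Zorn's lemma replaces the usual extension
  from a subspace. It is applied below \<open>tilt norm a\<close> rather than below
  \<open>norm\<close>, which forces the value \<open>norm a\<close> at \<open>a\<close>.\<close>

theorem norming_functional:
  fixes a :: "'v::real_normed_vector"
  obtains \<phi> :: "'v \<Rightarrow> real" where "bounded_linear \<phi>" "\<And>x. \<bar>\<phi> x\<bar> \<le> norm x" "\<phi> a = norm a"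
proof -
  define p0 where "p0 = tilt norm a"
  have norm_sub: "sublinear (norm :: 'v \<Rightarrow> real)"
    unfolding sublinear_def by (auto intro: norm_triangle_ineq)
  have p0: "sublinear p0" unfolding p0_def by (rule sublinear_tilt[OF norm_sub])
  define S where "S = {q. sublinear q \<and> (\<forall>x. q x \<le> p0 x)}"
  \<comment> \<open>The order is reversed: a maximal element for \<open>P\<close> is a minimal
    function.\<close>
  define P where "P = (\<lambda>q r :: 'v \<Rightarrow> real. \<forall>x. r x \<le> q x)"
  have "\<exists>m\<in>S. \<forall>q\<in>S. P m q \<longrightarrow> q = m"
  proof (rule predicate_Zorn)
    show "partial_order_on S (relation_of P S)"
      unfolding partial_order_on_def preorder_on_def refl_on_def trans_def antisym_def relation_of_def P_def
      by (auto intro: order_trans order_antisym intro!: ext)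
    fix C assume C: "C \<in> Chains (relation_of P S)"
    show "\<exists>u\<in>S. \<forall>q\<in>C. P q u"
    proof (cases "C = {}")
      case True
      then show ?thesis using p0 unfolding S_def by auto
    next
      case False
      have CS: "C \<subseteq> S" and tot: "\<And>q r. q \<in> C \<Longrightarrow> r \<in> C \<Longrightarrow> P q r \<or> P r q"
        using C unfolding Chains_def relation_of_def by blast+
      have 1: "sublinear q" if "q \<in> C" for q using CS that unfolding S_def by blast
      have 2: "q x \<le> p0 x" if "q \<in> C" for q x using CS that unfolding S_def by blast
      have 3: "(\<forall>x. q x \<le> r x) \<or> (\<forall>x. r x \<le> q x)" if "q \<in> C" "r \<in> C" for q r
        using tot[OF that] unfolding P_def by blast
      have inf: "sublinear (\<lambda>x. INF q\<in>C. q x)" "\<And>q x. q \<in> C \<Longrightarrow> (INF q\<in>C. q x) \<le> q x"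
        using sublinear_INF_chain[of C p0] False 1 2 3 by blast+
      have "(\<lambda>x. INF q\<in>C. q x) \<in> S"
        unfolding S_def using inf 2 False by (fastforce intro: order_trans)
      moreover have "P q (\<lambda>x. INF q\<in>C. q x)" if "q \<in> C" for q
        unfolding P_def using inf(2)[OF that] by blast
      ultimately show ?thesis by blast
    qed
  qed
  then obtain \<phi> where \<phi>: "sublinear \<phi>" "\<And>x. \<phi> x \<le> p0 x" and min: "\<And>q. q \<in> S \<Longrightarrow> P \<phi> q \<Longrightarrow> q = \<phi>"
    unfolding S_def by blast
  \<comment> \<open>Minimality forces the tilt of \<open>\<phi>\<close> in every direction to be \<open>\<phi>\<close> itself, which is superadditivity.\<close>
  have "tilt \<phi> b = \<phi>" for b
  proof (rule min)
    show "tilt \<phi> b \<in> S"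
      unfolding S_def using sublinear_tilt[OF \<phi>(1)] tilt_le_self[OF \<phi>(1)] \<phi>(2) by (blast intro: order_trans)
    show "P \<phi> (tilt \<phi> b)" unfolding P_def using tilt_le_self[OF \<phi>(1)] by blast
  qed
  then have "\<phi> x + \<phi> b \<le> \<phi> (x + b)" for x b
    using tilt_le[OF \<phi>(1), of 1 b x] by simp
  then have add: "\<phi> (x + y) = \<phi> x + \<phi> y" for x y
    using \<phi>(1) unfolding sublinear_def by (meson order_antisym)
  have pos: "\<phi> (c *\<^sub>R x) = c * \<phi> x" if "0 \<le> c" for c x
    using \<phi>(1) that unfolding sublinear_def by blast
  have minus: "\<phi> (- x) = - \<phi> x" for x
    using add[of x "- x"] pos[of 0 x] by simp
  have scale: "\<phi> (c *\<^sub>R x) = c * \<phi> x" for c x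
  proof (cases "0 \<le> c")
    case False
    then show ?thesis using pos[of "- c" x] minus[of "c *\<^sub>R x"] by simp
  qed (rule pos)
  have le: "\<phi> x \<le> norm x" for x
    using \<phi>(2)[of x] tilt_le_self[OF norm_sub, of a x] unfolding p0_def by simp
  have abs: "\<bar>\<phi> x\<bar> \<le> norm x" for x
    using le[of x] le[of "- x"] minus[of x] by simp
  have "bounded_linear \<phi>"
    by (rule bounded_linear_intro[of _ 1]) (use add scale abs in auto)
  moreover have "\<phi> a = norm a"
    using \<phi>(2)[of "- a"] tilt_le[OF norm_sub, of 1 a "- a"] minus[of a] le[of a]
    unfolding p0_def by simp
  ultimately show ?thesis using abs that by blast
qed

section \<open>Cauchy's theorem for cycles\<close>

text \<open>\<open>Cauchy_theorem_global\<close> speaks of one closed path. Each member of the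
  family is reached from \<open>x\<close> along a path inside the connected set \<open>S\<close> and
  left along its reversal; these connecting pieces cancel in integrals and winding numbers.\<close>

lemma cycle_homologous_loop:
  assumes S: "open S" "connected S" and x: "x \<in> S"
    and \<gamma>s: "\<And>\<gamma>. \<gamma> \<in> set \<gamma>s \<Longrightarrow> valid_path \<gamma> \<and> pathfinish \<gamma> = pathstart \<gamma> \<and> path_image \<gamma> \<subseteq> S"
  shows "\<exists>g. valid_path g \<and> pathstart g = x \<and> pathfinish g = x \<and> path_image g \<subseteq> S \<and>
           (\<forall>w. w \<notin> S \<longrightarrow> winding_number g w = (\<Sum>\<gamma>\<leftarrow>\<gamma>s. winding_number \<gamma> w)) \<and>
           (\<forall>f. f holomorphic_on S \<longrightarrow> contour_integral g f = (\<Sum>\<gamma>\<leftarrow>\<gamma>s. contour_integral \<gamma> f))"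
  using \<gamma>s
proof (induction \<gamma>s)
  case Nil
  define g where "g = linepath x x"
  have g: "valid_path g" "pathstart g = x" "pathfinish g = x" "path_image g \<subseteq> S"
    unfolding g_def using x by auto
  have "winding_number g w = 0" if "w \<notin> S" for w
    unfolding g_def using that x by (intro winding_number_trivial) auto
  moreover have "contour_integral g f = 0" for f
    unfolding g_def by (rule contour_integral_trivial)
  ultimately show ?case
    using g by (intro exI[of _ g]) auto
next
  case (Cons \<gamma> \<gamma>s)
  then obtain g where g: "valid_path g" "pathstart g = x" "pathfinish g = x" "path_image g \<subseteq> S"
    and gw: "\<And>w. w \<notin> S \<Longrightarrow> winding_number g w = (\<Sum>\<gamma>\<leftarrow>\<gamma>s. winding_number \<gamma> w)"
    and gi: "\<And>f. f holomorphic_on S \<Longrightarrow> contour_integral g f = (\<Sum>\<gamma>\<leftarrow>\<gamma>s. contour_integral \<gamma> f)"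
    by auto
  have \<gamma>: "valid_path \<gamma>" "pathfinish \<gamma> = pathstart \<gamma>" "path_image \<gamma> \<subseteq> S"
    using Cons.prems by auto
  then have "pathstart \<gamma> \<in> S" by auto
  then obtain q where "polynomial_function q" and q: "path_image q \<subseteq> S" "pathstart q = x" "pathfinish q = pathstart \<gamma>"
    using connected_open_polynomial_connected[OF S x] by blast
  then have vq: "valid_path q" by (simp add: valid_path_polynomial_function)
  define h where "h = (q +++ \<gamma> +++ reversepath q) +++ g"
  have vh: "valid_path h" "pathstart h = x" "pathfinish h = x" "path_image h \<subseteq> S"
    unfolding h_def using g \<gamma> q vq by (auto intro!: valid_path_join simp: path_image_join)
  have "winding_number h w = winding_number \<gamma> w + winding_number g w" if "w \<notin> S" for w
  proof -
    have "w \<notin> path_image q" "w \<notin> path_image \<gamma>" "w \<notin> path_image g" using that g \<gamma> q by auto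
    then show ?thesis
      unfolding h_def using g \<gamma> q vq
      by (simp add: winding_number_join winding_number_reversepath valid_path_imp_path path_image_join)
  qed
  moreover have "contour_integral h f = contour_integral \<gamma> f + contour_integral g f" if f: "f holomorphic_on S" for f
  proof -
    have "f contour_integrable_on q" "f contour_integrable_on \<gamma>" "f contour_integrable_on g"
      using contour_integrable_holomorphic_simple[OF f S(1)] vq q g \<gamma> by blast+
    then show ?thesis
      unfolding h_def using g \<gamma> q vq
      by (simp add: contour_integrable_reversepath contour_integral_reversepath)
  qed
  ultimately show ?case
    using vh gw gi by (intro exI[of _ h]) auto
qed

theorem Cauchy_theorem_cycle:
  assumes S: "open S" "connected S" and f: "f holomorphic_on S"
    and \<gamma>s: "\<And>\<gamma>. \<gamma> \<in> set \<gamma>s \<Longrightarrow> valid_path \<gamma> \<and> pathfinish \<gamma> = pathstart \<gamma> \<and> path_image \<gamma> \<subseteq> S"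
    and zero: "\<And>w. w \<notin> S \<Longrightarrow> (\<Sum>\<gamma>\<leftarrow>\<gamma>s. winding_number \<gamma> w) = 0"
  shows "(\<Sum>\<gamma>\<leftarrow>\<gamma>s. contour_integral \<gamma> f) = 0"
proof (cases "\<gamma>s = []")
  case False
  then obtain \<gamma> where "\<gamma> \<in> set \<gamma>s" by (cases \<gamma>s) auto
  then have x: "pathstart \<gamma> \<in> S" using \<gamma>s by blast
  obtain g where g: "valid_path g" "pathstart g = pathstart \<gamma>" "pathfinish g = pathstart \<gamma>" "path_image g \<subseteq> S"
    and gw: "\<And>w. w \<notin> S \<Longrightarrow> winding_number g w = (\<Sum>\<gamma>\<leftarrow>\<gamma>s. winding_number \<gamma> w)"
    and gi: "\<And>f. f holomorphic_on S \<Longrightarrow> contour_integral g f = (\<Sum>\<gamma>\<leftarrow>\<gamma>s. contour_integral \<gamma> f)"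
    using cycle_homologous_loop[OF S x \<gamma>s] by blast
  have "(f has_contour_integral 0) g"
    by (rule Cauchy_theorem_global[OF S(1) f g(1) _ g(4)]) (use g gw zero in auto)
  then show ?thesis using gi[OF f] by (simp add: contour_integral_unique)
qed auto

section \<open>Smoothing of paths and Cauchy transforms\<close>

lemma polynomial_path_same_integrals:
  assumes U: "open U" and \<gamma>: "valid_path \<gamma>" "path_image \<gamma> \<subseteq> U"
  obtains p where "polynomial_function p" "path_image p \<subseteq> U"
    "\<And>f. f holomorphic_on U \<Longrightarrow> contour_integral p f = contour_integral \<gamma> f"
proof -
  have "path \<gamma>" using \<gamma> by (simp add: valid_path_imp_path)
  obtain d where "d > 0"
    and d: "\<And>g h. \<lbrakk>valid_path g; valid_path h; \<forall>t\<in>{0..1}. cmod (g t - \<gamma> t) < d \<and> cmod (h t - \<gamma> t) < d;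
                   pathstart h = pathstart g \<and> pathfinish h = pathfinish g\<rbrakk>
              \<Longrightarrow> path_image h \<subseteq> U \<and> (\<forall>f. f holomorphic_on U \<longrightarrow> contour_integral h f = contour_integral g f)"
    using contour_integral_nearby_ends[OF U \<open>path \<gamma>\<close> \<gamma>(2)] by metis
  obtain p where p: "polynomial_function p" "pathstart p = pathstart \<gamma>" "pathfinish p = pathfinish \<gamma>"
      "\<And>t. t \<in> {0..1} \<Longrightarrow> cmod (p t - \<gamma> t) < d"
    using path_approx_polynomial_function[OF \<open>path \<gamma>\<close> \<open>d > 0\<close>] by metis
  have "path_image p \<subseteq> U \<and> (\<forall>f. f holomorphic_on U \<longrightarrow> contour_integral p f = contour_integral \<gamma> f)"
    by (rule d[OF \<gamma>(1)]) (use p \<open>d > 0\<close> valid_path_polynomial_function in auto)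
  with p show ?thesis using that by blast
qed

text \<open>A valid path may have an unbounded derivative, so it is first replaced by a polynomial one.\<close>

lemma cauchy_transform_holomorphic:
  assumes h: "h holomorphic_on U" and U: "open U" and \<gamma>: "valid_path \<gamma>" "path_image \<gamma> \<subseteq> U"
  shows "(\<lambda>z. contour_integral \<gamma> (\<lambda>u. h u / (u - z))) holomorphic_on (- path_image \<gamma>)"
proof -
  have "(\<lambda>z. contour_integral \<gamma> (\<lambda>u. h u / (u - z))) field_differentiable at z0" if z0: "z0 \<notin> path_image \<gamma>" for z0
  proof -
    have "open (- path_image \<gamma>)" using \<gamma> by (simp add: closed_valid_path_image open_Compl)
    then obtain e where e: "e > 0" "cball z0 e \<subseteq> - path_image \<gamma>"
      using z0 by (meson ComplI open_contains_cball)
    \<comment> \<open>Without the whole disc, \<open>h u / (u - z)\<close> is holomorphic for every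
      \<open>z\<close> in its interior, so one polynomial path serves all \<open>z\<close> near
      \<open>z0\<close>.\<close>
    have "open (U - cball z0 e)" "path_image \<gamma> \<subseteq> U - cball z0 e" using U \<gamma> e by auto
    then obtain p where p: "polynomial_function p" "path_image p \<subseteq> U - cball z0 e"
      and eq: "\<And>f. f holomorphic_on (U - cball z0 e) \<Longrightarrow> contour_integral p f = contour_integral \<gamma> f"
      using polynomial_path_same_integrals \<gamma>(1) by metis
    have vp: "valid_path p" using p by (simp add: valid_path_polynomial_function)
    obtain p' where p': "polynomial_function p'" "\<And>t. (p has_vector_derivative p' t) (at t)"
      using has_vector_derivative_polynomial_function p(1) by blast
    have "compact (p' ` {0..1})"
      using p'(1) by (intro compact_continuous_image continuous_on_polymonial_function) auto
    then obtain B where B: "\<And>t. t \<in> {0..1} \<Longrightarrow> norm (p' t) \<le> B"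
      by (meson bounded_iff compact_imp_bounded imageI)
    have hol: "(\<lambda>u. h u / (u - z)) holomorphic_on (U - cball z0 e)" if "z \<in> ball z0 e" for z
      using that by (intro holomorphic_intros holomorphic_on_subset[OF h]) auto
    have int: "((\<lambda>u. h u / (u - z)^1) has_contour_integral contour_integral \<gamma> (\<lambda>u. h u / (u - z))) p"
      if "z \<in> ball z0 e - path_image p" for z
    proof -
      have "(\<lambda>u. h u / (u - z)) contour_integrable_on p"
        using contour_integrable_holomorphic_simple[OF hol _ vp p(2)] that U by auto
      from has_contour_integral_integral[OF this] show ?thesis using eq[OF hol, of z] that by simp
    qed
    have "continuous_on (path_image p) h"
      using h p(2) by (meson Diff_subset continuous_on_subset holomorphic_on_imp_continuous_on order_trans)
    then have "((\<lambda>z. contour_integral \<gamma> (\<lambda>u. h u / (u - z))) has_field_derivative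
       (of_nat 1 * contour_integral p (\<lambda>u. h u / (u - z0)^Suc 1))) (at z0)"
      by (rule Cauchy_next_derivative(2)[where B = B and S = "ball z0 e"])
        (use int vp p e B vector_derivative_at[OF p'(2)] in auto)
    then show ?thesis using field_differentiable_def by blast
  qed
  then show ?thesis
    unfolding holomorphic_on_def by (auto intro: field_differentiable_at_within)
qed

text \<open>The two open half-planes are joined through the gap \<open>p\<close>, and
  \<open>- K\<close> lies between this union and its closure, the whole plane.\<close>

lemma connected_complement_imaginary:
  assumes K: "K \<subseteq> {z. Re z = 0}" and p: "Re p = 0" "p \<notin> K"
  shows "connected (- K)"
proof -
  have cr: "connected {z::complex. Re z > 0}" "connected {z::complex. Re z < 0}"
    by (auto intro!: convex_connected convex_halfspace_Re_gt convex_halfspace_Re_lt)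
  have cl: "closure {z::complex. Re z > 0} = {z. Re z \<ge> 0}" "closure {z::complex. Re z < 0} = {z. Re z \<le> 0}"
    using closure_halfspace_gt[of "1::complex" 0] closure_halfspace_lt[of "1::complex" 0] by (simp_all add: inner_complex_def)
  have 1: "connected (insert p {z::complex. Re z > 0})"
    by (rule connected_intermediate_closure[OF cr(1)]) (use p cl in auto)
  have 2: "connected (insert p {z::complex. Re z < 0})"
    by (rule connected_intermediate_closure[OF cr(2)]) (use p cl in auto)
  have 3: "connected (insert p {z::complex. Re z > 0} \<union> insert p {z. Re z < 0})"
    by (rule connected_Un[OF 1 2]) auto
  show ?thesis
  proof (rule connected_intermediate_closure[OF 3])
    show "insert p {z. Re z > 0} \<union> insert p {z. Re z < 0} \<subseteq> - K" using K p by auto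
    have "closure {z::complex. Re z > 0} \<union> closure {z. Re z < 0} = UNIV" using cl by auto
    moreover have "closure {z. Re z > 0} \<union> closure {z. Re z < 0}
        \<subseteq> closure (insert p {z::complex. Re z > 0} \<union> insert p {z. Re z < 0})"
      by (intro Un_least closure_mono) auto
    ultimately show "- K \<subseteq> closure (insert p {z. Re z > 0} \<union> insert p {z. Re z < 0})" by auto
  qed
qed

section \<open>Invertible operators\<close>

lemmas blinfun_compose_simps =
  bounded_bilinear.add_left[OF bounded_bilinear_blinfun_compose]
  bounded_bilinear.add_right[OF bounded_bilinear_blinfun_compose]
  bounded_bilinear.diff_left[OF bounded_bilinear_blinfun_compose]
  bounded_bilinear.diff_right[OF bounded_bilinear_blinfun_compose]
  bounded_bilinear.minus_left[OF bounded_bilinear_blinfun_compose]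
  bounded_bilinear.minus_right[OF bounded_bilinear_blinfun_compose]
  bounded_bilinear.scaleR_left[OF bounded_bilinear_blinfun_compose]
  bounded_bilinear.scaleR_right[OF bounded_bilinear_blinfun_compose]

lemma blinfun_compose_assoc: "(A o\<^sub>L B) o\<^sub>L C = A o\<^sub>L (B o\<^sub>L C)"
  by (rule blinfun_eqI) simp

lemma blinfun_compose_id [simp]: "id_blinfun o\<^sub>L A = A" "A o\<^sub>L id_blinfun = A"
  by (rule blinfun_eqI, simp)+

lemma blinfun_compose_commute:
  "X o\<^sub>L A = A o\<^sub>L X \<Longrightarrow> X o\<^sub>L B = B o\<^sub>L X \<Longrightarrow> X o\<^sub>L (A o\<^sub>L B) = (A o\<^sub>L B) o\<^sub>L X"
  by (rule blinfun_eqI) (metis blinfun_apply_blinfun_compose)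

lemma has_bounded_inverseI: "B o\<^sub>L A = id_blinfun \<Longrightarrow> A o\<^sub>L B = id_blinfun \<Longrightarrow> has_bounded_inverse A"
  unfolding has_bounded_inverse_def by blast

lemma binv:
  assumes "has_bounded_inverse A"
  shows "binv A o\<^sub>L A = id_blinfun" "A o\<^sub>L binv A = id_blinfun"
  using assms someI_ex[of "\<lambda>B. B o\<^sub>L A = id_blinfun \<and> A o\<^sub>L B = id_blinfun"]
  unfolding has_bounded_inverse_def binv_def by auto

lemma binv_unique:
  assumes "B o\<^sub>L A = id_blinfun" "A o\<^sub>L C = id_blinfun"
  shows "binv A = C"
proof -
  have "B = C" using assms by (metis blinfun_compose_assoc blinfun_compose_id)
  then have "has_bounded_inverse A" using assms has_bounded_inverseI by blast
  then show ?thesis using assms(2) binv(1) by (metis blinfun_compose_assoc blinfun_compose_id)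
qed

text \<open>Two operators \<open>A\<close> and \<open>A'\<close> are allowed because an antilinear
  \<open>W\<close> carries the resolvent at \<open>p\<close> to the resolvent at
  \<open>cnj p\<close>.\<close>

lemma binv_intertwine:
  assumes "has_bounded_inverse A" "has_bounded_inverse A'" "W o\<^sub>L A = A' o\<^sub>L W"
  shows "W o\<^sub>L binv A = binv A' o\<^sub>L W"
proof -
  have "W o\<^sub>L binv A = binv A' o\<^sub>L (A' o\<^sub>L W) o\<^sub>L binv A"
    by (simp add: binv(1)[OF assms(2)] blinfun_compose_assoc[symmetric])
  also have "\<dots> = binv A' o\<^sub>L W o\<^sub>L (A o\<^sub>L binv A)"
    by (simp only: assms(3)[symmetric] blinfun_compose_assoc)
  finally show ?thesis by (simp add: binv(2)[OF assms(1)])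
qed

lemma has_bounded_inverse_compose:
  assumes "has_bounded_inverse A" "has_bounded_inverse B"
  shows "has_bounded_inverse (A o\<^sub>L B)"
proof (rule has_bounded_inverseI[of "binv B o\<^sub>L binv A"])
  have "binv B o\<^sub>L binv A o\<^sub>L (A o\<^sub>L B) = binv B o\<^sub>L (binv A o\<^sub>L A) o\<^sub>L B"
    by (simp only: blinfun_compose_assoc)
  then show "binv B o\<^sub>L binv A o\<^sub>L (A o\<^sub>L B) = id_blinfun" by (simp add: binv assms)
  have "A o\<^sub>L B o\<^sub>L (binv B o\<^sub>L binv A) = A o\<^sub>L (B o\<^sub>L binv B) o\<^sub>L binv A"
    by (simp only: blinfun_compose_assoc)
  then show "A o\<^sub>L B o\<^sub>L (binv B o\<^sub>L binv A) = id_blinfun" by (simp add: binv assms)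
qed

lemma has_bounded_inverse_factor:
  assumes "has_bounded_inverse (A o\<^sub>L B)" "A o\<^sub>L B = B o\<^sub>L A"
  shows "has_bounded_inverse A"
proof (rule has_bounded_inverseI[of "B o\<^sub>L binv (A o\<^sub>L B)"])
  show "A o\<^sub>L (B o\<^sub>L binv (A o\<^sub>L B)) = id_blinfun"
    using binv(2)[OF assms(1)] by (simp add: blinfun_compose_assoc)
  have "A o\<^sub>L (A o\<^sub>L B) = (A o\<^sub>L B) o\<^sub>L A" using assms(2) by (metis blinfun_compose_assoc)
  then have c: "A o\<^sub>L binv (A o\<^sub>L B) = binv (A o\<^sub>L B) o\<^sub>L A"
    using binv_intertwine[OF assms(1) assms(1)] by blast
  have "B o\<^sub>L binv (A o\<^sub>L B) o\<^sub>L A = B o\<^sub>L A o\<^sub>L binv (A o\<^sub>L B)"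
    using c by (simp add: blinfun_compose_assoc)
  also have "\<dots> = id_blinfun" using assms binv(2) by metis
  finally show "B o\<^sub>L binv (A o\<^sub>L B) o\<^sub>L A = id_blinfun" .
qed

section \<open>Powers and Neumann series\<close>

definition bpow :: "('y::real_normed_vector \<Rightarrow>\<^sub>L 'y) \<Rightarrow> nat \<Rightarrow> 'y \<Rightarrow>\<^sub>L 'y" where
  "bpow a n = ((o\<^sub>L) a ^^ n) id_blinfun"

lemma bpow_0 [simp]: "bpow a 0 = id_blinfun"
  and bpow_Suc: "bpow a (Suc n) = a o\<^sub>L bpow a n"
  by (simp_all add: bpow_def)

lemma bpow_commute: "a o\<^sub>L b = b o\<^sub>L a \<Longrightarrow> bpow a n o\<^sub>L b = b o\<^sub>L bpow a n"
proof (induction n)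
  case (Suc n)
  have "bpow a (Suc n) o\<^sub>L b = a o\<^sub>L (bpow a n o\<^sub>L b)"
    by (simp only: bpow_Suc blinfun_compose_assoc)
  also have "\<dots> = (a o\<^sub>L b) o\<^sub>L bpow a n" by (simp only: Suc.IH[OF Suc.prems] blinfun_compose_assoc)
  finally show ?case by (simp only: Suc.prems bpow_Suc blinfun_compose_assoc)
qed simp

lemma bpow_Suc2: "bpow a (Suc n) = bpow a n o\<^sub>L a"
  by (simp add: bpow_Suc bpow_commute)

lemma bpow_compose:
  assumes "a o\<^sub>L b = b o\<^sub>L a"
  shows "bpow (a o\<^sub>L b) n = bpow a n o\<^sub>L bpow b n"
proof (induction n)
  case (Suc n)
  have "bpow (a o\<^sub>L b) (Suc n) = a o\<^sub>L (b o\<^sub>L bpow a n) o\<^sub>L bpow b n"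
    by (simp add: Suc bpow_Suc blinfun_compose_assoc)
  also have "b o\<^sub>L bpow a n = bpow a n o\<^sub>L b" using assms by (simp add: bpow_commute)
  finally show ?case by (simp add: bpow_Suc blinfun_compose_assoc)
qed simp

lemma bpow_scaleR: "bpow (c *\<^sub>R a) n = c ^ n *\<^sub>R bpow a n"
  by (induction n) (simp_all add: bpow_Suc blinfun_compose_simps)

lemma norm_bpow_le: "norm (bpow a n) \<le> norm a ^ n"
proof (induction n)
  case 0
  show ?case by (simp add: norm_blinfun_id_le)
next
  case (Suc n)
  have "norm (bpow a (Suc n)) \<le> norm a * norm (bpow a n)"
    unfolding bpow_Suc by (rule norm_blinfun_compose)
  also have "\<dots> \<le> norm a * norm a ^ n" using Suc by (simp add: mult_left_mono)
  finally show ?case by simp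
qed

text \<open>Summability of the powers is assumed instead of \<open>norm a < 1\<close>, since
  \<open>nonneg_spectrum_add\<close> controls the growth of the powers but not the norm of
  \<open>a\<close> itself.\<close>

lemma neumann_series:
  fixes a :: "'y::banach \<Rightarrow>\<^sub>L 'y"
  assumes "summable (\<lambda>n. norm (bpow a n))"
  shows "has_bounded_inverse (id_blinfun - a)" and "bpow a sums binv (id_blinfun - a)"
proof -
  have s: "summable (bpow a)" using assms by (rule summable_norm_cancel)
  define S where "S = suminf (bpow a)"
  have S: "bpow a sums S" unfolding S_def using s by (rule summable_sums)
  have "(\<lambda>n. bpow a (Suc n)) sums (S - bpow a 0)"
    using S by (simp only: sums_Suc_iff diff_add_cancel)
  moreover have "(\<lambda>n. a o\<^sub>L bpow a n) sums (a o\<^sub>L S)" "(\<lambda>n. bpow a n o\<^sub>L a) sums (S o\<^sub>L a)"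
    by (rule bounded_linear.sums[OF bounded_bilinear.bounded_linear_right[OF bounded_bilinear_blinfun_compose] S]
        bounded_linear.sums[OF bounded_bilinear.bounded_linear_left[OF bounded_bilinear_blinfun_compose] S])+
  ultimately have "a o\<^sub>L S = S - id_blinfun" "S o\<^sub>L a = S - id_blinfun"
    using sums_unique2[of "\<lambda>n. bpow a (Suc n)"] by (simp_all flip: bpow_Suc bpow_Suc2)
  then have *: "S o\<^sub>L (id_blinfun - a) = id_blinfun" "(id_blinfun - a) o\<^sub>L S = id_blinfun"
    by (simp_all add: blinfun_compose_simps)
  then show "has_bounded_inverse (id_blinfun - a)" by (rule has_bounded_inverseI)
  show "bpow a sums binv (id_blinfun - a)" using S binv_unique[OF *] by simp
qed

lemma neumann_series_norm_less_1:
  fixes a :: "'y::banach \<Rightarrow>\<^sub>L 'y"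
  assumes "norm a < 1"
  shows "has_bounded_inverse (id_blinfun - a)" and "bpow a sums binv (id_blinfun - a)"
proof -
  have "summable (\<lambda>n. norm (bpow a n))"
    by (rule summable_comparison_test'[of "\<lambda>n. norm a ^ n" 0])
      (use assms in \<open>auto simp: norm_bpow_le summable_geometric\<close>)
  then show "has_bounded_inverse (id_blinfun - a)" "bpow a sums binv (id_blinfun - a)"
    by (rule neumann_series)+
qed

section \<open>Openness of the set of invertible operators and continuity of inversion\<close>

lemma has_bounded_inverse_near:
  fixes A :: "'y::banach \<Rightarrow>\<^sub>L 'y"
  assumes A: "has_bounded_inverse A" and near: "norm (A - B) * norm (binv A) < 1"
  shows "has_bounded_inverse B"
proof -
  have "norm (binv A o\<^sub>L (A - B)) < 1"
    using norm_blinfun_compose[of "binv A" "A - B"] near by (simp add: mult.commute)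
  then have "has_bounded_inverse (A o\<^sub>L (id_blinfun - (binv A o\<^sub>L (A - B))))"
    by (intro has_bounded_inverse_compose A neumann_series_norm_less_1)
  moreover have "A o\<^sub>L (id_blinfun - (binv A o\<^sub>L (A - B))) = B"
    by (simp add: blinfun_compose_simps binv[OF A] blinfun_compose_assoc[symmetric])
  ultimately show ?thesis by simp
qed

lemma open_has_bounded_inverse: "open {A :: 'y::banach \<Rightarrow>\<^sub>L 'y. has_bounded_inverse A}"
  unfolding open_dist
proof clarify
  fix A :: "'y \<Rightarrow>\<^sub>L 'y" assume A: "has_bounded_inverse A"
  show "\<exists>e>0. \<forall>B. dist B A < e \<longrightarrow> B \<in> {A. has_bounded_inverse A}"
  proof (intro exI conjI allI impI)
    show "0 < 1 / (norm (binv A) + 1)" by (simp add: add_nonneg_pos)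
    fix B assume "dist B A < 1 / (norm (binv A) + 1)"
    then have "norm (A - B) * (norm (binv A) + 1) < 1"
      by (simp add: dist_norm norm_minus_commute pos_less_divide_eq add_nonneg_pos)
    then have "norm (A - B) * norm (binv A) < 1"
      by (smt (verit) mult_left_mono norm_ge_zero)
    then show "B \<in> {A. has_bounded_inverse A}" using has_bounded_inverse_near[OF A] by simp
  qed
qed

lemma binv_diff:
  assumes "has_bounded_inverse A" "has_bounded_inverse B"
  shows "binv B - binv A = binv B o\<^sub>L (A - B) o\<^sub>L binv A"
  using assms by (simp add: blinfun_compose_simps binv blinfun_compose_assoc)

lemma continuous_on_binv: "continuous_on {A :: 'y::banach \<Rightarrow>\<^sub>L 'y. has_bounded_inverse A} binv"
proof -
  have "(binv \<longlongrightarrow> binv A) (at A)" if A: "has_bounded_inverse A" for A :: "'y \<Rightarrow>\<^sub>L 'y"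
  proof -
    define c where "c = norm (binv A)"
    have c: "0 \<le> c" unfolding c_def by simp
    have ev: "\<forall>\<^sub>F B in at A. has_bounded_inverse B"
      using open_has_bounded_inverse A by (metis eventually_at_topological mem_Collect_eq)
    have lim: "((\<lambda>B. norm (A - B)) \<longlongrightarrow> 0) (at A)"
      by (rule tendsto_eq_intros refl | simp)+
    \<comment> \<open>With the bound 1/2 the unknown \<open>norm (binv B)\<close> on the right of
      the estimate can be absorbed, giving \<open>norm (binv B) \<le> 2 * c\<close>.\<close>
    have ev2: "\<forall>\<^sub>F B in at A. norm (A - B) * c < 1 / 2"
    proof -
      have "((\<lambda>B. norm (A - B) * c) \<longlongrightarrow> 0) (at A)" using tendsto_mult_right[OF lim, of c] by simp
      then show ?thesis by (rule order_tendstoD) simp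
    qed
    have "\<forall>\<^sub>F B in at A. norm (binv B - binv A) \<le> 2 * c * c * norm (A - B)"
      using ev ev2
    proof eventually_elim
      case (elim B)
      have d: "norm (binv B - binv A) \<le> norm (binv B) * norm (A - B) * c"
        unfolding binv_diff[OF A elim(1)] c_def
        by (rule order_trans[OF norm_blinfun_compose]) (simp add: mult_right_mono norm_blinfun_compose)
      have "norm (binv B) \<le> c + norm (binv B - binv A)"
        unfolding c_def by (metis add.commute diff_add_cancel norm_triangle_ineq)
      also have "\<dots> \<le> c + norm (binv B) * (1/2)"
        using d elim(2) by (smt (verit) mult.assoc mult_left_mono norm_ge_zero)
      finally have "norm (binv B) \<le> 2 * c" by simp
      then have "norm (binv B) * (norm (A - B) * c) \<le> 2 * c * (norm (A - B) * c)"
        by (intro mult_right_mono) (use c in auto)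
      with d show ?case by (simp add: mult_ac)
    qed
    moreover have "((\<lambda>B. 2 * c * c * norm (A - B)) \<longlongrightarrow> 0) (at A)"
      using tendsto_mult_left[OF lim, of "2 * c * c"] by simp
    ultimately have "((\<lambda>B. binv B - binv A) \<longlongrightarrow> 0) (at A)"
      by (rule Lim_null_comparison)
    then show ?thesis by (simp add: LIM_zero_iff)
  qed
  then show ?thesis by (auto intro!: continuous_at_imp_continuous_on simp: isCont_def)
qed

section \<open>Operator-valued holomorphic functions\<close>

locale complex_structure =
  fixes I :: "'y::banach \<Rightarrow>\<^sub>L 'y"
  assumes I_sq: "I o\<^sub>L I = - id_blinfun"
begin

text \<open>Complex scalars act on the real space through \<open>I\<close>. An operator is
  complex-linear exactly when it commutes with \<open>I\<close>, so linearity becomes a hypothesis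
  that can fail, as it may for \<open>qop T\<close>.\<close>

definition csc :: "complex \<Rightarrow> 'y \<Rightarrow>\<^sub>L 'y" where
  "csc z = Re z *\<^sub>R id_blinfun + Im z *\<^sub>R I"

lemma csc_simps [simp]: "csc 0 = 0" "csc 1 = id_blinfun" "csc \<i> = I"
  and csc_add: "csc (z + w) = csc z + csc w"
  and csc_diff: "csc (z - w) = csc z - csc w"
  and csc_minus: "csc (- z) = - csc z"
  and csc_of_real: "csc (of_real r) = r *\<^sub>R id_blinfun"
  and csc_scaleR: "csc (r *\<^sub>R z) = r *\<^sub>R csc z"
  by (simp_all add: csc_def algebra_simps)

lemma csc_mult: "csc (z * w) = csc z o\<^sub>L csc w"
  by (simp add: csc_def blinfun_compose_simps I_sq algebra_simps)

lemma norm_csc: "norm (csc z) \<le> (1 + norm I) * norm z"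
proof -
  have "norm (csc z) \<le> \<bar>Re z\<bar> * norm (id_blinfun :: 'y \<Rightarrow>\<^sub>L 'y) + \<bar>Im z\<bar> * norm I"
    unfolding csc_def by (metis norm_scaleR norm_triangle_ineq)
  also have "\<dots> \<le> norm z * 1 + norm z * norm I"
    by (intro add_mono mult_mono norm_blinfun_id_le abs_Re_le_cmod abs_Im_le_cmod) auto
  finally show ?thesis by (simp add: algebra_simps)
qed

lemma bounded_linear_csc: "bounded_linear csc"
  using norm_csc by (intro bounded_linear_intro[of _ "1 + norm I"]) (simp_all add: csc_add csc_scaleR mult.commute)

lemmas continuous_on_csc [continuous_intros] = bounded_linear.continuous_on[OF bounded_linear_csc]

lemma csc_commute: "I o\<^sub>L A = A o\<^sub>L I \<Longrightarrow> csc z o\<^sub>L A = A o\<^sub>L csc z"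
  by (simp add: csc_def blinfun_compose_simps)

lemma has_bounded_inverse_csc: "z \<noteq> 0 \<Longrightarrow> has_bounded_inverse (csc z)"
  by (rule has_bounded_inverseI[of "csc (inverse z)"]) (simp_all flip: csc_mult)

text \<open>Complex-linear functionals on the operator space, with the imaginary unit acting by left
  composition with \<open>I\<close>. Right composition with any operator preserves this property,
  left composition with one that commutes with \<open>I\<close> does too.\<close>

definition cfun :: "(('y \<Rightarrow>\<^sub>L 'y) \<Rightarrow> complex) \<Rightarrow> bool" where
  "cfun \<Phi> \<longleftrightarrow> bounded_linear \<Phi> \<and> (\<forall>a. \<Phi> (I o\<^sub>L a) = \<i> * \<Phi> a)"

lemma cfun_bounded_linear: "cfun \<Phi> \<Longrightarrow> bounded_linear \<Phi>"
  by (simp add: cfun_def)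

lemma cfun_csc: 
  assumes "cfun \<Phi>" shows "\<Phi> (csc z o\<^sub>L a) = z * \<Phi> a"
proof -
  interpret \<Phi>: bounded_linear \<Phi> using assms by (rule cfun_bounded_linear)
  have "\<Phi> (csc z o\<^sub>L a) = Re z *\<^sub>R \<Phi> a + Im z *\<^sub>R (\<i> * \<Phi> a)"
    using assms by (simp add: csc_def blinfun_compose_simps \<Phi>.add \<Phi>.scaleR cfun_def)
  also have "\<dots> = z * \<Phi> a"
    by (simp add: complex_eq_iff algebra_simps)
  finally show ?thesis .
qed

lemma cfun_compose_right: "cfun \<Phi> \<Longrightarrow> cfun (\<lambda>a. \<Phi> (a o\<^sub>L b))"
  unfolding cfun_def
  by (auto simp: blinfun_compose_assoc
      intro!: bounded_linear_compose[OF _ bounded_bilinear.bounded_linear_left[OF bounded_bilinear_blinfun_compose]])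

lemma cfun_compose_left:
  assumes "cfun \<Phi>" "I o\<^sub>L b = b o\<^sub>L I" shows "cfun (\<lambda>a. \<Phi> (b o\<^sub>L a))"
proof -
  have "b o\<^sub>L (I o\<^sub>L a) = I o\<^sub>L (b o\<^sub>L a)" for a
    by (simp only: assms(2) flip: blinfun_compose_assoc)
  then have "\<Phi> (b o\<^sub>L (I o\<^sub>L a)) = \<i> * \<Phi> (b o\<^sub>L a)" for a
    using assms(1) unfolding cfun_def by metis
  then show ?thesis
    using bounded_linear_compose[OF cfun_bounded_linear[OF assms(1)]
        bounded_bilinear.bounded_linear_right[OF bounded_bilinear_blinfun_compose]]
    unfolding cfun_def by blast
qed

text \<open>The standard complexification \<open>\<phi> x - \<i> * \<phi> (I x)\<close> of a real
  norming functional. The factor \<open>1 + norm I\<close> appears because \<open>I\<close> need not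
  be an isometry; that it does not depend on \<open>a\<close> is what makes the bound in
  \<open>power_bounded\<close> uniform in \<open>n\<close>.\<close>

lemma norming_cfun:
  obtains \<Phi> where "cfun \<Phi>" "norm a \<le> norm (\<Phi> a)" "\<And>x. norm (\<Phi> x) \<le> (1 + norm I) * norm x"
proof -
  obtain \<phi> :: "('y \<Rightarrow>\<^sub>L 'y) \<Rightarrow> real" where \<phi>: "bounded_linear \<phi>" "\<And>x. \<bar>\<phi> x\<bar> \<le> norm x" "\<phi> a = norm a"
    using norming_functional by blast
  interpret \<phi>: bounded_linear \<phi> by fact
  define \<Phi> where "\<Phi> = (\<lambda>x. Complex (\<phi> x) (- \<phi> (I o\<^sub>L x)))"
  have bound: "norm (\<Phi> x) \<le> (1 + norm I) * norm x" for x
  proof -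
    have "norm (\<Phi> x) \<le> \<bar>\<phi> x\<bar> + \<bar>\<phi> (I o\<^sub>L x)\<bar>"
      unfolding \<Phi>_def using cmod_le[of "Complex (\<phi> x) (- \<phi> (I o\<^sub>L x))"] by simp
    also have "\<dots> \<le> norm x + norm I * norm x"
      by (meson \<phi>(2) add_mono norm_blinfun_compose order_trans)
    finally show ?thesis by (simp add: algebra_simps)
  qed
  have "bounded_linear \<Phi>"
    by (rule bounded_linear_intro[of _ "1 + norm I"])
      (use bound in \<open>simp_all add: \<Phi>_def blinfun_compose_simps \<phi>.add \<phi>.scaleR complex_eq_iff mult.commute\<close>)
  moreover have "\<Phi> (I o\<^sub>L x) = \<i> * \<Phi> x" for x
    unfolding \<Phi>_def
    by (simp add: blinfun_compose_assoc[symmetric] I_sq blinfun_compose_simps \<phi>.neg complex_eq_iff)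
  ultimately have "cfun \<Phi>" by (simp add: cfun_def)
  moreover have "norm a \<le> norm (\<Phi> a)"
    using complex_Re_le_cmod[of "\<Phi> a"] \<phi>(3) by (simp add: \<Phi>_def)
  ultimately show ?thesis using that bound by blast
qed

lemma cfun_separates:
  assumes "\<And>\<Phi>. cfun \<Phi> \<Longrightarrow> \<Phi> a = \<Phi> b"
  shows "a = b"
proof -
  obtain \<Phi> where \<Phi>: "cfun \<Phi>" "norm (a - b) \<le> norm (\<Phi> (a - b))"
    using norming_cfun by blast
  have "\<Phi> (a - b) = 0"
    using assms[OF \<Phi>(1)] linear_diff[OF bounded_linear.linear[OF cfun_bounded_linear[OF \<Phi>(1)]]] by simp
  with \<Phi>(2) show ?thesis by simp
qed

text \<open>Weak holomorphy together with norm continuity; the latter makes the segment integrals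
  exist and turns them into primitives in norm.\<close>

definition op_holomorphic :: "(complex \<Rightarrow> 'y \<Rightarrow>\<^sub>L 'y) \<Rightarrow> complex set \<Rightarrow> bool" where
  "op_holomorphic f U \<longleftrightarrow> continuous_on U f \<and> (\<forall>\<Phi>. cfun \<Phi> \<longrightarrow> (\<lambda>z. \<Phi> (f z)) holomorphic_on U)"

lemma op_holomorphic_subset: "op_holomorphic f U \<Longrightarrow> V \<subseteq> U \<Longrightarrow> op_holomorphic f V"
  unfolding op_holomorphic_def by (meson continuous_on_subset holomorphic_on_subset)

text \<open>The form \<open>z A + B\<close> covers both uses: the resolvent of \<open>- D\<close>
  with \<open>A = id_blinfun\<close>, and the generating function \<open>(1 - w a)^-1\<close> of the
  powers of \<open>a\<close> with \<open>A = - a\<close>.\<close>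

lemma op_holomorphic_pencil:
  assumes A: "I o\<^sub>L A = A o\<^sub>L I" and B: "I o\<^sub>L B = B o\<^sub>L I"
    and inv: "\<And>z. z \<in> U \<Longrightarrow> has_bounded_inverse ((csc z o\<^sub>L A) + B)"
  shows "op_holomorphic (\<lambda>z. binv ((csc z o\<^sub>L A) + B)) U"
proof -
  define M where "M = (\<lambda>z. (csc z o\<^sub>L A) + B)"
  have cont: "continuous_on U (\<lambda>z. binv (M z))"
    by (rule continuous_on_compose2[OF continuous_on_binv])
      (use inv in \<open>auto simp: M_def intro!: continuous_intros
          bounded_bilinear.continuous_on[OF bounded_bilinear_blinfun_compose]\<close>)
  have comm: "I o\<^sub>L binv (M z) = binv (M z) o\<^sub>L I" if "z \<in> U" for z
  proof (rule binv_intertwine)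
    have "I o\<^sub>L csc z = csc z o\<^sub>L I" by (rule csc_commute[symmetric]) simp
    then show "I o\<^sub>L M z = M z o\<^sub>L I"
      unfolding M_def by (simp add: blinfun_compose_simps blinfun_compose_commute A B)
  qed (use inv that in \<open>auto simp: M_def\<close>)
  have "(\<lambda>z. \<Phi> (binv (M z))) holomorphic_on U" if \<Phi>: "cfun \<Phi>" for \<Phi>
  proof -
    interpret \<Phi>: bounded_linear \<Phi> using \<Phi> by (rule cfun_bounded_linear)
    have "((\<lambda>z. \<Phi> (binv (M z))) has_field_derivative (- \<Phi> (binv (M z) o\<^sub>L (A o\<^sub>L binv (M z))))) (at z within U)"
      if z: "z \<in> U" for z
      unfolding has_field_derivative_iff
    proof (rule Lim_transform_eventually)
      have "((\<lambda>w. binv (M w)) \<longlongrightarrow> binv (M z)) (at z within U)"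
        using cont z unfolding continuous_on_def by blast
      then show "((\<lambda>w. - \<Phi> (binv (M w) o\<^sub>L (A o\<^sub>L binv (M z)))) \<longlongrightarrow> - \<Phi> (binv (M z) o\<^sub>L (A o\<^sub>L binv (M z)))) (at z within U)"
        by (intro tendsto_minus \<Phi>.tendsto bounded_bilinear.tendsto[OF bounded_bilinear_blinfun_compose] tendsto_const)
      show "\<forall>\<^sub>F w in at z within U. - \<Phi> (binv (M w) o\<^sub>L (A o\<^sub>L binv (M z))) = (\<Phi> (binv (M w)) - \<Phi> (binv (M z))) / (w - z)"
        unfolding eventually_at_filter
      proof (rule always_eventually, intro allI impI)
        fix w assume w: "w \<noteq> z" "w \<in> U"
        \<comment> \<open>The resolvent identity turns the difference quotient into an expression
          that is continuous in \<open>w\<close>.\<close>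
        have "binv (M w) - binv (M z) = binv (M w) o\<^sub>L (M z - M w) o\<^sub>L binv (M z)"
          by (rule binv_diff) (use inv w z in \<open>auto simp: M_def\<close>)
        also have "M z - M w = csc (z - w) o\<^sub>L A"
          by (simp add: M_def csc_diff blinfun_compose_simps)
        also have "binv (M w) o\<^sub>L (csc (z - w) o\<^sub>L A) = csc (z - w) o\<^sub>L (binv (M w) o\<^sub>L A)"
          by (simp only: csc_commute[OF comm[OF w(2)]] flip: blinfun_compose_assoc)
        finally have "\<Phi> (binv (M w)) - \<Phi> (binv (M z)) = (z - w) * \<Phi> (binv (M w) o\<^sub>L (A o\<^sub>L binv (M z)))"
          using cfun_csc[OF \<Phi>] by (simp add: blinfun_compose_assoc flip: \<Phi>.diff)
        then show "- \<Phi> (binv (M w) o\<^sub>L (A o\<^sub>L binv (M z))) = (\<Phi> (binv (M w)) - \<Phi> (binv (M z))) / (w - z)"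
          using w by (simp add: field_simps)
      qed
    qed
    then show ?thesis unfolding holomorphic_on_def field_differentiable_def by blast
  qed
  with cont show ?thesis unfolding op_holomorphic_def M_def by blast
qed

lemma op_holomorphic_mult_csc:
  assumes f: "op_holomorphic f U" and g: "g holomorphic_on U"
  shows "op_holomorphic (\<lambda>z. csc (g z) o\<^sub>L f z) U"
proof -
  have "continuous_on U (\<lambda>z. csc (g z) o\<^sub>L f z)"
    using f g unfolding op_holomorphic_def
    by (intro bounded_bilinear.continuous_on[OF bounded_bilinear_blinfun_compose] continuous_on_csc
        holomorphic_on_imp_continuous_on) auto
  moreover have "(\<lambda>z. \<Phi> (csc (g z) o\<^sub>L f z)) holomorphic_on U" if "cfun \<Phi>" for \<Phi>
    using f g that unfolding op_holomorphic_def by (simp add: cfun_csc holomorphic_on_mult)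
  ultimately show ?thesis unfolding op_holomorphic_def by blast
qed

lemma op_holomorphic_compose:
  assumes f: "op_holomorphic f V" and g: "g holomorphic_on U" "g ` U \<subseteq> V"
  shows "op_holomorphic (\<lambda>z. f (g z)) U"
proof -
  have "continuous_on U (\<lambda>z. f (g z))"
    using f g unfolding op_holomorphic_def
    by (intro continuous_on_compose2[of V f U g] holomorphic_on_imp_continuous_on) auto
  moreover have "(\<lambda>z. \<Phi> (f (g z))) holomorphic_on U" if "cfun \<Phi>" for \<Phi>
    using f g that holomorphic_on_compose_gen[of g U "\<lambda>z. \<Phi> (f z)" V]
    unfolding op_holomorphic_def o_def by blast
  ultimately show ?thesis unfolding op_holomorphic_def by blast
qed

text \<open>Additivity of the segment integrals is a scalar statement after applying a functional,
  where a primitive is known to exist. Norm continuity of \<open>f\<close> then gives the derivative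
  as in the scalar proof.\<close>

lemma op_holomorphic_primitive:
  assumes U: "open U" "convex U" and f: "op_holomorphic f U"
  obtains G where "\<And>z. z \<in> U \<Longrightarrow> (G has_derivative (\<lambda>h. csc h o\<^sub>L f z)) (at z)"
proof (cases "U = {}")
  case False
  then obtain z0 where z0: "z0 \<in> U" by blast
  define seg where "seg = (\<lambda>z w. integral {0..1} (\<lambda>t. csc (w - z) o\<^sub>L f (linepath z w t)))"
  have line: "linepath z w t \<in> U" if "z \<in> U" "w \<in> U" "t \<in> {0..1}" for z w t
    using that convexD_alt[OF U(2), of z w t] by (auto simp: linepath_def)
  have int: "(\<lambda>t. csc (w - z) o\<^sub>L f (linepath z w t)) integrable_on {0..1}" if "z \<in> U" "w \<in> U" for z w
  proof (rule integrable_continuous_interval)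
    have "continuous_on {0..1} (\<lambda>t. f (linepath z w t))"
      by (rule continuous_on_compose2[of U f]) (use f line that in \<open>auto simp: op_holomorphic_def\<close>)
    then show "continuous_on {0..1} (\<lambda>t. csc (w - z) o\<^sub>L f (linepath z w t))"
      by (intro bounded_bilinear.continuous_on[OF bounded_bilinear_blinfun_compose] continuous_on_const)
  qed
  have seg_diff: "seg z0 w - seg z0 z = seg z w" if zw: "z \<in> U" "w \<in> U" for z w
  proof (rule cfun_separates)
    fix \<Phi> assume \<Phi>: "cfun \<Phi>"
    interpret \<Phi>: bounded_linear \<Phi> using \<Phi> by (rule cfun_bounded_linear)
    have "(\<lambda>z. \<Phi> (f z)) holomorphic_on U" using f \<Phi> unfolding op_holomorphic_def by blast
    then obtain F where F: "\<And>x. x \<in> U \<Longrightarrow> (F has_field_derivative \<Phi> (f x)) (at x within U)"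
      using holomorphic_convex_primitive'[OF U(2,1)] by metis
    have "\<Phi> (seg a b) = F b - F a" if ab: "a \<in> U" "b \<in> U" for a b
    proof -
      have "((\<lambda>t. csc (b - a) o\<^sub>L f (linepath a b t)) has_integral seg a b) {0..1}"
        unfolding seg_def using int[OF ab] by (rule integrable_integral)
      then have "((\<lambda>t. \<Phi> (csc (b - a) o\<^sub>L f (linepath a b t))) has_integral \<Phi> (seg a b)) {0..1}"
        using has_integral_linear[OF _ \<Phi>.bounded_linear_axioms] by (simp add: o_def)
      then have "((\<lambda>z. \<Phi> (f z)) has_contour_integral \<Phi> (seg a b)) (linepath a b)"
        unfolding has_contour_integral_linepath by (simp add: cfun_csc[OF \<Phi>] mult.commute)
      moreover have "path_image (linepath a b) \<subseteq> U"
        using ab U(2) by (simp add: closed_segment_subset)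
      then have "((\<lambda>z. \<Phi> (f z)) has_contour_integral (F b - F a)) (linepath a b)"
        using contour_integral_primitive[OF F, of "linepath a b"] by simp
      ultimately show ?thesis by (rule has_contour_integral_unique)
    qed
    then show "\<Phi> (seg z0 w - seg z0 z) = \<Phi> (seg z w)" using zw z0 by (simp add: \<Phi>.diff)
  qed
  define C where "C = 1 + norm I"
  have C: "C > 0" unfolding C_def by (simp add: add_pos_nonneg)
  have "(seg z0 has_derivative (\<lambda>h. csc h o\<^sub>L f z)) (at z)" if z: "z \<in> U" for z
    unfolding has_derivative_at_alt
  proof (intro conjI allI impI)
    show "bounded_linear (\<lambda>h. csc h o\<^sub>L f z)"
      by (intro bounded_linear_compose[OF bounded_bilinear.bounded_linear_left[OF bounded_bilinear_blinfun_compose]]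
          bounded_linear_csc)
    fix e :: real assume e: "e > 0"
    have "continuous (at z) f"
      using f z U(1) unfolding op_holomorphic_def by (simp add: continuous_on_eq_continuous_at)
    then obtain d1 where d1: "d1 > 0" "\<And>w. dist w z < d1 \<Longrightarrow> dist (f w) (f z) < e / C"
      unfolding continuous_at_eps_delta using divide_pos_pos[OF e C] by blast
    obtain d2 where d2: "d2 > 0" "ball z d2 \<subseteq> U" using U(1) z by (meson open_contains_ball)
    show "\<exists>d>0. \<forall>w. norm (w - z) < d \<longrightarrow> norm (seg z0 w - seg z0 z - (csc (w - z) o\<^sub>L f z)) \<le> e * norm (w - z)"
    proof (intro exI conjI allI impI)
      show "min d1 d2 > 0" using d1 d2 by simp
      fix w assume w: "norm (w - z) < min d1 d2"
      then have wU: "w \<in> U" using d2 by (auto simp: dist_norm norm_minus_commute)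
      have "((\<lambda>t. csc (w - z) o\<^sub>L f (linepath z w t)) has_integral seg z w) {0..1}"
        unfolding seg_def using int[OF z wU] by (rule integrable_integral)
      moreover have "((\<lambda>t::real. csc (w - z) o\<^sub>L f z) has_integral (csc (w - z) o\<^sub>L f z)) {0..1}"
        using has_integral_const_real[of "csc (w - z) o\<^sub>L f z" 0 1] by simp
      ultimately have "((\<lambda>t. (csc (w - z) o\<^sub>L f (linepath z w t)) - (csc (w - z) o\<^sub>L f z))
          has_integral (seg z w - (csc (w - z) o\<^sub>L f z))) {0..1}"
        by (rule has_integral_diff)
      moreover have "norm ((csc (w - z) o\<^sub>L f (linepath z w t)) - (csc (w - z) o\<^sub>L f z)) \<le> e * norm (w - z)"
        if t: "t \<in> {0..1}" for t
      proof -
        have "norm (linepath z w t - z) = \<bar>t\<bar> * norm (w - z)"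
          unfolding linepath_def by (simp add: algebra_simps flip: norm_scaleR scaleR_diff_right)
        also have "\<dots> \<le> norm (w - z)" using t by (simp add: mult_left_le_one_le)
        finally have "dist (f (linepath z w t)) (f z) < e / C" using w by (intro d1) (simp add: dist_norm)
        then have "norm (f (linepath z w t) - f z) \<le> e / C" by (simp add: dist_norm)
        then have "norm (csc (w - z) o\<^sub>L (f (linepath z w t) - f z)) \<le> (C * norm (w - z)) * (e / C)"
          unfolding C_def by (intro order_trans[OF norm_blinfun_compose] mult_mono norm_csc) auto
        then show ?thesis using C by (simp add: blinfun_compose_simps mult.commute)
      qed
      ultimately have "norm (seg z w - (csc (w - z) o\<^sub>L f z)) \<le> (e * norm (w - z)) * measure lborel {0..1::real}"
        by (intro has_integral_bound_real[of _ "{}"]) (use e in auto)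
      then show "norm (seg z0 w - seg z0 z - (csc (w - z) o\<^sub>L f z)) \<le> e * norm (w - z)"
        by (simp add: seg_diff[OF z wU])
    qed
  qed
  then show ?thesis using that by blast
qed (use that in blast)

definition op_integrand :: "(complex \<Rightarrow> 'y \<Rightarrow>\<^sub>L 'y) \<Rightarrow> (real \<Rightarrow> complex) \<Rightarrow> real \<Rightarrow> 'y \<Rightarrow>\<^sub>L 'y" where
  "op_integrand f \<gamma> t = csc (vector_derivative \<gamma> (at t within {0..1})) o\<^sub>L f (\<gamma> t)"

text \<open>The derivative of a valid path may be unbounded, so that continuity of \<open>f\<close> would not suffice
  here; local primitives and the fundamental theorem of calculus do.\<close>

lemma op_integrand_integrable:
  assumes U: "open U" and f: "op_holomorphic f U" and \<gamma>: "valid_path \<gamma>" "path_image \<gamma> \<subseteq> U"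
  shows "op_integrand f \<gamma> integrable_on {0..1}"
proof -
  obtain S where S: "finite S" "\<gamma> C1_differentiable_on ({0..1} - S)" and cont: "continuous_on {0..1} \<gamma>"
    using \<gamma>(1) unfolding valid_path_def piecewise_C1_differentiable_on_def by blast
  have "op_integrand f \<gamma> integrable_on cbox 0 1"
  \<comment> \<open>It suffices to work near each \<open>t0\<close>, where the path stays in a disc
    inside \<open>U\<close> and a primitive is available.\<close>
  proof (rule integrable_on_little_subintervals, intro ballI)
    fix t0 :: real assume "t0 \<in> cbox 0 1"
    then have t0: "t0 \<in> {0..1}" by simp
    then have "\<gamma> t0 \<in> U" using \<gamma>(2) by (auto simp: path_image_def)
    then obtain e where e: "e > 0" "ball (\<gamma> t0) e \<subseteq> U" using U by (meson open_contains_ball)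
    obtain G where G: "\<And>z. z \<in> ball (\<gamma> t0) e \<Longrightarrow> (G has_derivative (\<lambda>h. csc h o\<^sub>L f z)) (at z)"
      using op_holomorphic_primitive[OF _ _ op_holomorphic_subset[OF f e(2)]] by auto
    obtain d where d: "d > 0" "\<And>t. t \<in> {0..1} \<Longrightarrow> dist t t0 < d \<Longrightarrow> dist (\<gamma> t) (\<gamma> t0) < e"
      using cont t0 e(1) unfolding continuous_on_iff by metis
    show "\<exists>d>0. \<forall>u v. t0 \<in> cbox u v \<and> cbox u v \<subseteq> ball t0 d \<and> cbox u v \<subseteq> cbox 0 1 \<longrightarrow>
             op_integrand f \<gamma> integrable_on cbox u v"
    proof (intro exI conjI allI impI)
      show "d > 0" by fact
      fix u v :: real assume "t0 \<in> cbox u v \<and> cbox u v \<subseteq> ball t0 d \<and> cbox u v \<subseteq> cbox 0 1"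
      then have uv: "u \<le> v" "{u..v} \<subseteq> ball t0 d" "{u..v} \<subseteq> {0..1}" by auto
      have ball: "\<gamma> t \<in> ball (\<gamma> t0) e" if "t \<in> {u..v}" for t
        using d(2)[of t] uv that by (auto simp: dist_commute)
      have "(op_integrand f \<gamma> has_integral ((G \<circ> \<gamma>) v - (G \<circ> \<gamma>) u)) {u..v}"
      proof (rule fundamental_theorem_of_calculus_interior_strong[OF S(1) uv(1)])
        have "continuous_on (ball (\<gamma> t0) e) G"
          using G by (meson continuous_at_imp_continuous_on has_derivative_continuous)
        then show "continuous_on {u..v} (G \<circ> \<gamma>)"
          unfolding o_def
          by (rule continuous_on_compose2[OF _ continuous_on_subset[OF cont uv(3)]]) (use ball in blast)
        fix t assume t: "t \<in> {u<..<v} - S"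
        then have t01: "t \<in> {0<..<1}" using uv by auto
        have "\<gamma> differentiable at t"
          using S(2) t t01 by (auto simp: C1_differentiable_on_eq)
        then have "(\<gamma> has_vector_derivative vector_derivative \<gamma> (at t)) (at t)"
          by (simp add: vector_derivative_works)
        moreover have "at t within {0..1} = at t" using t01 by (intro at_within_Icc_at) auto
        ultimately have v: "(\<gamma> has_derivative (\<lambda>x. x *\<^sub>R vector_derivative \<gamma> (at t within {0..1}))) (at t)"
          by (simp add: has_vector_derivative_def)
        have "(G \<circ> \<gamma> has_derivative (\<lambda>h. csc h o\<^sub>L f (\<gamma> t)) \<circ> (\<lambda>x. x *\<^sub>R vector_derivative \<gamma> (at t within {0..1}))) (at t)"
          by (rule diff_chain_at[OF v G]) (use ball t in auto)
        then show "(G \<circ> \<gamma> has_vector_derivative op_integrand f \<gamma> t) (at t)"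
          by (simp add: has_vector_derivative_def op_integrand_def o_def csc_scaleR blinfun_compose_simps)
      qed
      then show "op_integrand f \<gamma> integrable_on cbox u v" by auto
    qed
  qed
  then show ?thesis by simp
qed

definition op_integral :: "(complex \<Rightarrow> 'y \<Rightarrow>\<^sub>L 'y) \<Rightarrow> (real \<Rightarrow> complex) list \<Rightarrow> 'y \<Rightarrow>\<^sub>L 'y" where
  "op_integral f \<gamma>s = (\<Sum>\<gamma>\<leftarrow>\<gamma>s. integral {0..1} (op_integrand f \<gamma>))"

lemma cfun_op_integral:
  assumes U: "open U" and f: "op_holomorphic f U"
    and \<gamma>s: "\<And>\<gamma>. \<gamma> \<in> set \<gamma>s \<Longrightarrow> valid_path \<gamma> \<and> path_image \<gamma> \<subseteq> U" and \<Phi>: "cfun \<Phi>"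
  shows "\<Phi> (op_integral f \<gamma>s) = (\<Sum>\<gamma>\<leftarrow>\<gamma>s. contour_integral \<gamma> (\<lambda>z. \<Phi> (f z)))"
  using \<gamma>s unfolding op_integral_def
proof (induction \<gamma>s)
  case Nil
  then show ?case using linear_0[OF bounded_linear.linear[OF cfun_bounded_linear[OF \<Phi>]]] by simp
next
  case (Cons \<gamma> \<gamma>s)
  interpret \<Phi>: bounded_linear \<Phi> using \<Phi> by (rule cfun_bounded_linear)
  have "(op_integrand f \<gamma> has_integral integral {0..1} (op_integrand f \<gamma>)) {0..1}"
    using op_integrand_integrable[OF U f, of \<gamma>] Cons.prems by (intro integrable_integral) auto
  then have "((\<lambda>t. \<Phi> (op_integrand f \<gamma> t)) has_integral \<Phi> (integral {0..1} (op_integrand f \<gamma>))) {0..1}"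
    using has_integral_linear[OF _ \<Phi>.bounded_linear_axioms] by (simp add: o_def)
  then have "((\<lambda>z. \<Phi> (f z)) has_contour_integral \<Phi> (integral {0..1} (op_integrand f \<gamma>))) \<gamma>"
    unfolding has_contour_integral_def op_integrand_def by (simp add: cfun_csc[OF \<Phi>] mult.commute)
  then show ?case using Cons by (simp add: \<Phi>.add contour_integral_unique)
qed

end

section \<open>Sums of commuting operators with nonnegative spectrum\<close>

context complex_structure
begin

lemma open_pencil_resolvent_set:
  "open {z. has_bounded_inverse ((csc z o\<^sub>L A) + B)}"
proof -
  have "continuous_on UNIV (\<lambda>z. (csc z o\<^sub>L A) + B)"
    by (intro continuous_intros bounded_bilinear.continuous_on[OF bounded_bilinear_blinfun_compose])
  then have "open ((\<lambda>z. (csc z o\<^sub>L A) + B) -` {X. has_bounded_inverse X})"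
    using open_has_bounded_inverse by (rule open_vimage[rotated])
  then show ?thesis by (simp add: vimage_def)
qed

lemma bpow_csc: "bpow (csc w) n = csc (w ^ n)"
  by (induction n) (simp_all add: bpow_Suc csc_mult)

text \<open>The Cauchy inequality for \<open>w \<mapsto> (1 - w a)\<^sup>-\<^sup>1\<close>, whose Taylor coefficients are the powers of \<open>a\<close>.\<close>

lemma power_bounded:
  assumes a: "I o\<^sub>L a = a o\<^sub>L I"
    and inv: "\<And>w. norm w \<le> 1 \<Longrightarrow> has_bounded_inverse (id_blinfun - (csc w o\<^sub>L a))"
  obtains M where "\<And>n. norm (bpow a n) \<le> M"
proof -
  have pencil: "(csc w o\<^sub>L (- a)) + id_blinfun = id_blinfun - (csc w o\<^sub>L a)" for w
    by (simp add: blinfun_compose_simps)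
  define F where "F = (\<lambda>w. binv (id_blinfun - (csc w o\<^sub>L a)))"
  define C where "C = 1 + norm I"
  have C: "C > 0" unfolding C_def by (simp add: add_pos_nonneg)
  have hol: "op_holomorphic F (cball 0 1)"
    using op_holomorphic_pencil[of "- a" id_blinfun "cball 0 1"] a inv
    unfolding F_def pencil by (simp add: blinfun_compose_simps)
  then have "compact (F ` cball 0 1)"
    unfolding op_holomorphic_def by (intro compact_continuous_image) auto
  then obtain B where B: "\<And>w. norm w \<le> 1 \<Longrightarrow> norm (F w) \<le> B"
    by (metis bounded_iff compact_imp_bounded imageI mem_cball_0)
  have "norm (bpow a n) \<le> C * B" for n
  proof -
    obtain \<Phi> where \<Phi>: "cfun \<Phi>" "norm (bpow a n) \<le> norm (\<Phi> (bpow a n))" "\<And>x. norm (\<Phi> x) \<le> C * norm x"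
      unfolding C_def using norming_cfun by blast
    interpret \<Phi>: bounded_linear \<Phi> using \<Phi>(1) by (rule cfun_bounded_linear)
    define f where "f = (\<lambda>w. \<Phi> (F w))"
    have f: "f holomorphic_on cball 0 1" using hol \<Phi>(1) unfolding f_def op_holomorphic_def by blast
    have "f has_fps_expansion Abs_fps (\<lambda>k. \<Phi> (bpow a k))"
    proof (rule has_fps_expansionI)
      \<comment> \<open>For \<open>norm w < r\<close> the norm estimate gives
        \<open>norm (w a) < 1\<close>; the summand 1 keeps the denominator positive when
        \<open>a = 0\<close>.\<close>
      define r where "r = 1 / (C * norm a + 1)"
      have r: "r > 0" unfolding r_def using C by (simp add: add_nonneg_pos)
      have "(\<lambda>k. fps_nth (Abs_fps (\<lambda>k. \<Phi> (bpow a k))) k * w ^ k) sums f w" if w: "dist w 0 < r" for w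
      proof -
        have "norm (csc w o\<^sub>L a) \<le> (C * norm w) * norm a"
          unfolding C_def by (intro order_trans[OF norm_blinfun_compose] mult_right_mono norm_csc) auto
        also have "\<dots> = norm w * (C * norm a)" by simp
        also have "\<dots> \<le> norm w * (C * norm a + 1)" by (simp add: mult_left_mono)
        also have "\<dots> < 1"
          using w C unfolding r_def by (simp add: pos_less_divide_eq add_nonneg_pos)
        finally have "bpow (csc w o\<^sub>L a) sums F w"
          unfolding F_def by (rule neumann_series_norm_less_1)
        then have "(\<lambda>k. \<Phi> (bpow (csc w o\<^sub>L a) k)) sums \<Phi> (F w)" by (rule \<Phi>.sums)
        moreover have "\<Phi> (bpow (csc w o\<^sub>L a) k) = \<Phi> (bpow a k) * w ^ k" for k
          by (simp add: bpow_compose[OF csc_commute[OF a]] bpow_csc cfun_csc[OF \<Phi>(1)])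
        ultimately show ?thesis by (simp add: f_def)
      qed
      then show "\<forall>\<^sub>F w in nhds 0. (\<lambda>k. fps_nth (Abs_fps (\<lambda>k. \<Phi> (bpow a k))) k * w ^ k) sums f w"
        using r unfolding eventually_nhds_metric by blast
    qed
    then have "\<Phi> (bpow a n) = (deriv ^^ n) f 0 / fact n"
      using fps_nth_fps_expansion[of f "Abs_fps (\<lambda>k. \<Phi> (bpow a k))" n] by simp
    moreover have "norm ((deriv ^^ n) f 0) \<le> fact n * (C * B) / 1 ^ n"
    proof (rule Cauchy_inequality)
      show "f holomorphic_on ball 0 1" using f by (rule holomorphic_on_subset) auto
      show "continuous_on (cball 0 1) f" using f by (rule holomorphic_on_imp_continuous_on)
      fix x :: complex assume "norm (0 - x) = 1"
      then have "norm (F x) \<le> B" by (intro B) simp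
      then show "norm (f x) \<le> C * B"
        unfolding f_def using C by (intro order_trans[OF \<Phi>(3)]) (simp add: mult_left_mono)
    qed simp
    ultimately have "norm (\<Phi> (bpow a n)) \<le> C * B"
      by (simp add: norm_divide divide_le_eq mult.commute)
    with \<Phi>(2) show ?thesis by simp
  qed
  then show ?thesis using that by blast
qed

text \<open>The sign is adapted to \<open>z^2 + D\<close>: a singular \<open>\<mu> + B\<close> means
  that \<open>- \<mu>\<close> is in the spectrum of \<open>B\<close>, which thus lies on the closed
  half-line from 0 to infinity.\<close>

definition nonneg_spectrum :: "('y \<Rightarrow>\<^sub>L 'y) \<Rightarrow> bool" where
  "nonneg_spectrum B \<longleftrightarrow> I o\<^sub>L B = B o\<^sub>L I \<and>
     (\<forall>\<mu>. \<mu> \<notin> \<real>\<^sub>\<le>\<^sub>0 \<longrightarrow> has_bounded_inverse (csc \<mu> + B))"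

lemma has_bounded_inverse_large:
  assumes "(1 + norm I) * norm B < norm \<nu>"
  shows "has_bounded_inverse (csc \<nu> + B)"
proof -
  have "0 \<le> (1 + norm I) * norm B" by simp
  with assms have "0 < norm \<nu>" by linarith
  then have \<nu>: "\<nu> \<noteq> 0" by simp
  have "norm (csc (inverse \<nu>) o\<^sub>L (- B)) \<le> ((1 + norm I) * norm (inverse \<nu>)) * norm B"
    by (rule order_trans[OF norm_blinfun_compose]) (simp add: mult_right_mono norm_csc del: norm_inverse)
  also have "\<dots> = ((1 + norm I) * norm B) / norm \<nu>" by (simp add: norm_inverse divide_inverse mult_ac)
  also have "\<dots> < 1" using assms \<open>0 < norm \<nu>\<close> by simp
  finally have "has_bounded_inverse (csc \<nu> o\<^sub>L (id_blinfun - (csc (inverse \<nu>) o\<^sub>L (- B))))"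
    by (intro has_bounded_inverse_compose has_bounded_inverse_csc \<nu> neumann_series_norm_less_1)
  moreover have "csc \<nu> o\<^sub>L (id_blinfun - (csc (inverse \<nu>) o\<^sub>L (- B))) = csc \<nu> + B"
    using \<nu> by (simp add: blinfun_compose_simps flip: csc_mult blinfun_compose_assoc)
  ultimately show ?thesis by simp
qed

text \<open>The spectrum of \<open>B\<close> lies inside and that of \<open>- \<mu> - C\<close> outside a large circle with centre \<open>c\<close>,
  so that \<open>\<mu> + B + C = N (1 + N\<^sup>-\<^sup>1 (B - c))\<close> with \<open>N = \<mu> + c + C\<close> is inverted by a Neumann series.\<close>

lemma nonneg_spectrum_add:
  assumes B: "nonneg_spectrum B" and C: "nonneg_spectrum C" and comm: "B o\<^sub>L C = C o\<^sub>L B"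
  shows "nonneg_spectrum (B + C)"
proof -
  have IB: "I o\<^sub>L B = B o\<^sub>L I" and IC: "I o\<^sub>L C = C o\<^sub>L I" using B C by (auto simp: nonneg_spectrum_def)
  have "has_bounded_inverse (csc \<mu> + (B + C))" if \<mu>: "\<mu> \<notin> \<real>\<^sub>\<le>\<^sub>0" for \<mu>
  proof -
    \<comment> \<open>The half-plane \<open>Re (e * z) \<le> 0\<close> contains the closed negative
      half-line but not \<open>\<mu>\<close>.\<close>
    obtain e where e: "norm e = 1" "Re e \<ge> 0" "Re (e * \<mu>) > 0"
    proof (cases "Re \<mu> > 0")
      case True
      then show ?thesis using that[of 1] by simp
    next
      case False
      then have "Im \<mu> \<noteq> 0" using \<mu> by (auto simp: complex_nonpos_Reals_iff)
      then show ?thesis using that[of \<i>] that[of "- \<i>"] by (cases "Im \<mu> > 0") auto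
    qed
    define h where "h = Re (e * \<mu>)"
    define M where "M = (1 + norm I) * norm B"
    \<comment> \<open>\<open>R\<close> solves \<open>2 * R * h = M^2\<close>, so that
      \<open>r0 < R + h\<close>. Here \<open>r0\<close> bounds the distance from \<open>c\<close> to
      the points of the interval from 0 to \<open>M\<close>, while a disc about \<open>c\<close> of
      radius below \<open>R + h\<close> misses the spectrum of \<open>- \<mu> - C\<close> after the
      reflection used in \<open>outside\<close>. The radii \<open>r1 < r2\<close> divide the gap
      into thirds.\<close>
    define R where "R = M\<^sup>2 / (2 * h)"
    define c where "c = of_real R * cnj e"
    define r0 where "r0 = sqrt (R\<^sup>2 + M\<^sup>2)"
    define r1 where "r1 = (2 * r0 + (R + h)) / 3"
    define r2 where "r2 = (r0 + 2 * (R + h)) / 3"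
    have h: "h > 0" and M: "M \<ge> 0" and R: "R \<ge> 0"
      using e by (auto simp: h_def M_def R_def)
    have "R\<^sup>2 + M\<^sup>2 < (R + h)\<^sup>2" using h by (simp add: R_def power2_eq_square field_simps)
    then have "r0 < R + h" unfolding r0_def using h R by (intro real_less_lsqrt) auto
    moreover have "r0 \<ge> 0" by (simp add: r0_def)
    ultimately have r: "r0 < r1" "r1 < r2" "r2 < R + h" "r0 \<ge> 0" "r1 > 0" "r2 > 0"
      by (auto simp: r1_def r2_def)
    have ee: "e * cnj e = 1" using e(1) by (simp add: complex_mult_cnj cmod_def)
    have ec: "e * c = of_real R" unfolding c_def using ee by (simp add: mult.left_commute)
    \<comment> \<open>Since \<open>Re e \<ge> 0\<close>, a nonnegative \<open>x\<close> satisfies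
      \<open>|x - c|^2 \<le> x^2 + R^2\<close>. At distance at least \<open>r1 > r0\<close> this
      forces \<open>x > M\<close>, where the norm of \<open>B\<close> already gives
      invertibility.\<close>
    have inside: "has_bounded_inverse (csc (- \<nu>) + B)" if \<nu>: "r1 \<le> norm (\<nu> - c)" for \<nu>
    proof (cases "- \<nu> \<in> \<real>\<^sub>\<le>\<^sub>0")
      case False
      then show ?thesis using B unfolding nonneg_spectrum_def by blast
    next
      case True
      define x where "x = Re \<nu>"
      have x: "\<nu> = of_real x" "x \<ge> 0"
        using True by (auto simp: x_def complex_nonpos_Reals_iff complex_eq_iff)
      have "(norm (\<nu> - c))\<^sup>2 = (x - R * Re e)\<^sup>2 + (R * Im e)\<^sup>2"
        unfolding cmod_power2 by (simp add: x c_def)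
      also have "\<dots> = x\<^sup>2 - 2 * x * R * Re e + R\<^sup>2 * ((Re e)\<^sup>2 + (Im e)\<^sup>2)"
        by (simp add: power2_eq_square algebra_simps)
      also have "(Re e)\<^sup>2 + (Im e)\<^sup>2 = 1" using e(1) by (simp flip: cmod_power2)
      also have "x\<^sup>2 - 2 * x * R * Re e + R\<^sup>2 * 1 \<le> x\<^sup>2 + R\<^sup>2"
        using x R e by simp
      finally have "(norm (\<nu> - c))\<^sup>2 \<le> x\<^sup>2 + R\<^sup>2" .
      moreover have "r0\<^sup>2 < (norm (\<nu> - c))\<^sup>2" using \<nu> r by (intro power_strict_mono) auto
      ultimately have "M\<^sup>2 < x\<^sup>2" unfolding r0_def by simp
      then have "M < x" using x(2) by (rule power_less_imp_less_base)
      then show ?thesis using x by (intro has_bounded_inverse_large) (simp add: M_def)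
    qed
    have outside: "has_bounded_inverse (csc (\<mu> + c - \<nu>) + C)" if \<nu>: "norm \<nu> \<le> r2" for \<nu>
    proof -
      have "Re (e * \<nu>) \<le> r2"
        using complex_Re_le_cmod[of "e * \<nu>"] e(1) \<nu> by (simp add: norm_mult)
      then have pos: "Re (e * (\<mu> + c - \<nu>)) > 0"
        using ec r by (simp add: algebra_simps h_def)
      have "\<mu> + c - \<nu> \<notin> \<real>\<^sub>\<le>\<^sub>0"
      proof
        assume "\<mu> + c - \<nu> \<in> \<real>\<^sub>\<le>\<^sub>0"
        then obtain y where "\<mu> + c - \<nu> = of_real y" "y \<le> 0" by (auto elim: nonpos_Reals_cases)
        then have "Re (e * (\<mu> + c - \<nu>)) = Re e * y" by simp
        also have "\<dots> \<le> 0" using e(2) \<open>y \<le> 0\<close> by (simp add: mult_nonneg_nonpos)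
        finally show False using pos by simp
      qed
      then show ?thesis using C unfolding nonneg_spectrum_def by blast
    qed
    define N where "N = csc (\<mu> + c) + C"
    have N: "has_bounded_inverse N" using outside[of 0] r by (simp add: N_def)
    have IN: "I o\<^sub>L N = N o\<^sub>L I" and BN: "B o\<^sub>L N = N o\<^sub>L B"
      unfolding N_def using csc_commute[OF IB] csc_commute[of I] by (simp_all add: blinfun_compose_simps IC comm)
    have IN': "I o\<^sub>L binv N = binv N o\<^sub>L I" and BN': "B o\<^sub>L binv N = binv N o\<^sub>L B"
      using binv_intertwine[OF N N] IN BN by blast+
    \<comment> \<open>The scaling makes \<open>1 - w b\<close> and \<open>1 - w k\<close> invertible
      on the closed unit disc, so both operators have bounded powers.\<close>
    define b where "b = (1 / r1) *\<^sub>R (B - csc c)"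
    define k where "k = r2 *\<^sub>R binv N"
    have Ib: "I o\<^sub>L b = b o\<^sub>L I" and Ik: "I o\<^sub>L k = k o\<^sub>L I"
      unfolding b_def k_def using csc_commute[of I c] by (simp_all add: blinfun_compose_simps IB IN')
    have bk: "k o\<^sub>L b = b o\<^sub>L k"
      unfolding b_def k_def using csc_commute[OF IN', of c] by (simp add: blinfun_compose_simps BN' scaleR_diff_right)
    obtain M1 where M1: "\<And>n. norm (bpow b n) \<le> M1"
    proof (rule power_bounded[OF Ib])
      fix w :: complex assume w: "norm w \<le> 1"
      show "has_bounded_inverse (id_blinfun - (csc w o\<^sub>L b))"
      proof (cases "w = 0")
        case True
        then show ?thesis by (auto intro: has_bounded_inverseI[of id_blinfun])
      next
        case False
        \<comment> \<open>Solves \<open>1 - w b = - (w / r1) (B - \<nu>)\<close>;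
          \<open>norm w \<le> 1\<close> puts it on or outside the circle of radius
          \<open>r1\<close>.\<close>
        define \<nu> where "\<nu> = c + of_real r1 / w"
        have "norm (\<nu> - c) = r1 / norm w" using r by (simp add: \<nu>_def norm_divide)
        then have "r1 \<le> norm (\<nu> - c)" using w False r by (simp add: pos_le_divide_eq)
        then have "has_bounded_inverse (csc (- w / of_real r1) o\<^sub>L (csc (- \<nu>) + B))"
          using False r by (intro has_bounded_inverse_compose has_bounded_inverse_csc inside) auto
        moreover have "csc (- w / of_real r1) o\<^sub>L (csc (- \<nu>) + B) = id_blinfun - (csc w o\<^sub>L b)"
        proof -
          have 1: "- w / of_real r1 = (1 / r1) *\<^sub>R (- w)" by (simp add: scaleR_conv_of_real)
          have 2: "(- w / of_real r1) * (- \<nu>) = 1 + (1 / r1) *\<^sub>R (w * c)"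
            using False r by (simp add: \<nu>_def field_simps scaleR_conv_of_real)
          have "csc (- w / of_real r1) o\<^sub>L (csc (- \<nu>) + B)
              = csc ((- w / of_real r1) * (- \<nu>)) + (csc (- w / of_real r1) o\<^sub>L B)"
            by (simp only: csc_mult blinfun_compose_simps)
          also have "\<dots> = id_blinfun + (1 / r1) *\<^sub>R (csc w o\<^sub>L csc c) - (1 / r1) *\<^sub>R (csc w o\<^sub>L B)"
            unfolding 2 unfolding 1
            by (simp add: csc_add csc_scaleR csc_minus csc_mult blinfun_compose_simps)
          finally show ?thesis by (simp add: b_def blinfun_compose_simps algebra_simps)
        qed
        ultimately show ?thesis by simp
      qed
    qed blast
    obtain M2 where M2: "\<And>n. norm (bpow k n) \<le> M2"
    proof (rule power_bounded[OF Ik])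
      fix w :: complex assume w: "norm w \<le> 1"
      have "norm (of_real r2 * w) \<le> r2" using w r by (simp add: norm_mult)
      then have "has_bounded_inverse (binv N o\<^sub>L (csc (\<mu> + c - of_real r2 * w) + C))"
        using N by (intro has_bounded_inverse_compose outside) (auto intro: has_bounded_inverseI[of N] binv)
      moreover have "csc (\<mu> + c - of_real r2 * w) + C = N - r2 *\<^sub>R csc w"
        by (simp add: N_def csc_diff scaleR_conv_of_real[symmetric] csc_scaleR)
      moreover have "binv N o\<^sub>L (N - r2 *\<^sub>R csc w) = id_blinfun - (csc w o\<^sub>L k)"
        by (simp add: blinfun_compose_simps binv[OF N] k_def csc_commute[OF IN'])
      ultimately show "has_bounded_inverse (id_blinfun - (csc w o\<^sub>L k))" by simp
    qed blast
    \<comment> \<open>The operator \<open>a\<close> below is \<open>- N^-1 (B - c)\<close>. As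
      \<open>k\<close> and \<open>b\<close> commute, their bounded powers leave geometric decay at
      the rate \<open>r1 / r2\<close>.\<close>
    define q where "q = r1 / r2"
    have q: "0 < q" "q < 1" using r by (auto simp: q_def)
    define a where "a = (- q) *\<^sub>R (k o\<^sub>L b)"
    have "norm (bpow a n) \<le> (M2 * M1) * q ^ n" for n
    proof -
      have "norm (bpow a n) = q ^ n * norm (bpow k n o\<^sub>L bpow b n)"
        using q by (simp add: a_def bpow_scaleR bpow_compose[OF bk] power_abs del: scaleR_minus_left)
      also have "\<dots> \<le> q ^ n * (M2 * M1)"
      proof (rule mult_left_mono)
        have "0 \<le> M2" using M2[of n] norm_ge_zero order_trans by blast
        then show "norm (bpow k n o\<^sub>L bpow b n) \<le> M2 * M1"
          using M1[of n] M2[of n] by (intro order_trans[OF norm_blinfun_compose] mult_mono) auto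
      qed (use q in simp)
      finally show ?thesis by (simp add: mult.commute)
    qed
    moreover have "summable (\<lambda>n. (M2 * M1) * q ^ n)"
      by (rule summable_mult[OF summable_geometric]) (use q in simp)
    ultimately have "summable (\<lambda>n. norm (bpow a n))"
      using summable_comparison_test'[of "\<lambda>n. (M2 * M1) * q ^ n" 0 "\<lambda>n. norm (bpow a n)"] by simp
    then have "has_bounded_inverse (N o\<^sub>L (id_blinfun - a))"
      by (intro has_bounded_inverse_compose N neumann_series)
    moreover have "N o\<^sub>L (id_blinfun - a) = csc \<mu> + (B + C)"
    proof -
      have "N o\<^sub>L (id_blinfun - a) = N + q *\<^sub>R (N o\<^sub>L (k o\<^sub>L b))"
        by (simp add: a_def blinfun_compose_simps)
      also have "N o\<^sub>L (k o\<^sub>L b) = r2 *\<^sub>R b"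
        by (simp add: k_def blinfun_compose_simps binv[OF N] flip: blinfun_compose_assoc)
      also have "q *\<^sub>R (r2 *\<^sub>R b) = B - csc c" using r by (simp add: q_def b_def)
      finally show ?thesis by (simp add: N_def csc_add)
    qed
    ultimately show ?thesis by simp
  qed
  then show ?thesis
    unfolding nonneg_spectrum_def by (simp add: blinfun_compose_simps IB IC)
qed

text \<open>\<open>\<mu> + A^2 = (\<tau> + A) (- \<tau> + A)\<close> with
  \<open>\<tau>^2 = - \<mu>\<close>, and \<open>\<tau>\<close> is not real when \<open>\<mu>\<close>
  is off the closed negative half-line.\<close>

lemma nonneg_spectrum_square:
  assumes A: "I o\<^sub>L A = A o\<^sub>L I" and inv: "\<And>\<mu>. Im \<mu> \<noteq> 0 \<Longrightarrow> has_bounded_inverse (csc \<mu> + A)"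
  shows "nonneg_spectrum (A o\<^sub>L A)"
proof -
  have "has_bounded_inverse (csc \<mu> + (A o\<^sub>L A))" if "\<mu> \<notin> \<real>\<^sub>\<le>\<^sub>0" for \<mu>
  proof -
    define \<tau> where "\<tau> = \<i> * csqrt \<mu>"
    have "Re (csqrt \<mu>) \<noteq> 0"
    proof
      assume "Re (csqrt \<mu>) = 0"
      then have "Re ((csqrt \<mu>)\<^sup>2) \<le> 0" "Im ((csqrt \<mu>)\<^sup>2) = 0"
        by (simp_all only: Re_power2 Im_power2) auto
      then show False using that by (simp add: complex_nonpos_Reals_iff)
    qed
    then have "Im \<tau> \<noteq> 0" by (simp add: \<tau>_def)
    then have "has_bounded_inverse ((csc \<tau> + A) o\<^sub>L (csc (- \<tau>) + A))"
      by (intro has_bounded_inverse_compose inv) auto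
    moreover have "(csc \<tau> + A) o\<^sub>L (csc (- \<tau>) + A) = csc (- (\<tau> * \<tau>)) + (A o\<^sub>L A)"
      using csc_commute[OF A, of \<tau>] by (simp add: blinfun_compose_simps csc_minus csc_mult algebra_simps)
    moreover have "- (\<tau> * \<tau>) = \<mu>"
      unfolding \<tau>_def by (simp add: algebra_simps flip: power2_eq_square)
    ultimately show ?thesis by simp
  qed
  then show ?thesis
    unfolding nonneg_spectrum_def using A by (auto intro: blinfun_compose_commute)
qed

end

section \<open>The Riesz projection\<close>

lemma holomorphic_on_sum_list:
  "(\<And>x. x \<in> set xs \<Longrightarrow> f x holomorphic_on S) \<Longrightarrow> (\<lambda>z. \<Sum>x\<leftarrow>xs. f x z) holomorphic_on S"
  by (induction xs) (simp_all add: holomorphic_on_add)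

text \<open>In use, \<open>q\<close> is a functional applied to a product of resolvents at
  \<open>p\<close> and \<open>z\<close>, and \<open>a\<close>, \<open>b\<close> are its values on
  the single resolvents at \<open>z\<close> and \<open>p\<close>. The factor \<open>p\<close> is
  what gives the poles \<open>z\<close> and \<open>- z\<close> equal weights.\<close>

lemma partial_fractions_pm:
  fixes p z q a b :: complex
  assumes ne: "p - z \<noteq> 0" "p + z \<noteq> 0" and q: "q * ((p - z) * (p + z)) = a - b"
  shows "p * q = - (1/2) * (b / (p - z)) + - (1/2) * (b / (p - - z))
           + ((a / 2) * (1 / (p - z)) + (a / 2) * (1 / (p - - z)))"
proof -
  define u where "u = 1 / (p - z)"
  define v where "v = 1 / (p + z)"
  have uv: "(p - z) * u = 1" "(p + z) * v = 1" using ne by (auto simp: u_def v_def)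
  have "p * q * 2 = (a - b) * (u + v)" using uv q by algebra
  then have "p * q = ((a - b) * (u + v)) / 2" by (subst nonzero_eq_divide_eq) auto
  also have "\<dots> = - (1/2) * (b * u) + - (1/2) * (b * v) + ((a / 2) * u + (a / 2) * v)"
    by (simp add: field_simps)
  finally show ?thesis by (simp add: u_def v_def)
qed

locale nonneg_operator = complex_structure I for I :: "'y::banach \<Rightarrow>\<^sub>L 'y" +
  fixes D :: "'y \<Rightarrow>\<^sub>L 'y"
  assumes D: "nonneg_spectrum D"
begin

text \<open>In the application this is the part of the S-spectrum in the slice through
  \<open>J\<close>.\<close>

definition K :: "complex set" where
  "K = {z. \<not> has_bounded_inverse (csc (z\<^sup>2) + D)}"

definition Res :: "complex \<Rightarrow> 'y \<Rightarrow>\<^sub>L 'y" where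
  "Res z = binv (csc (z\<^sup>2) + D)"

lemma I_D: "I o\<^sub>L D = D o\<^sub>L I"
  using D by (simp add: nonneg_spectrum_def)

lemma K_imaginary: "z \<in> K \<Longrightarrow> Re z = 0"
proof (rule ccontr)
  assume "z \<in> K" "Re z \<noteq> 0"
  then have "z\<^sup>2 \<in> \<real>\<^sub>\<le>\<^sub>0" using D unfolding K_def nonneg_spectrum_def by blast
  with \<open>Re z \<noteq> 0\<close> show False
    by (auto simp: complex_nonpos_Reals_iff Re_power2 Im_power2 sum_power2_le_zero_iff)
qed

lemma K_minus [simp]: "- z \<in> K \<longleftrightarrow> z \<in> K"
  by (simp add: K_def)

lemma K_cnj: "z \<in> K \<Longrightarrow> cnj z = - z"
  using K_imaginary by (simp add: complex_eq_iff)

lemma K_cnj_iff [simp]: "cnj z \<in> K \<longleftrightarrow> z \<in> K"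
proof
  assume "cnj z \<in> K"
  then show "z \<in> K" using K_cnj[of "cnj z"] K_minus[of "cnj z"] by simp
next
  assume "z \<in> K"
  then show "cnj z \<in> K" using K_cnj[of z] K_minus[of z] by simp
qed

lemma open_Compl_K: "open (- K)"
proof -
  have "- K = (\<lambda>z. z\<^sup>2) -` {w. has_bounded_inverse ((csc w o\<^sub>L id_blinfun) + D)}"
    by (auto simp: K_def)
  also have "open \<dots>"
    by (intro open_vimage open_pencil_resolvent_set continuous_intros)
  finally show ?thesis .
qed

text \<open>\<open>K\<close> is bounded, so the imaginary axis has a gap at \<open>p\<close>: there
  \<open>norm (p^2) = (1 + c)^2\<close> exceeds the bound \<open>c\<close> for invertibility.
  Subsets \<open>L\<close> are needed because the idempotence proof removes the singularities inside
  the contour.\<close>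

lemma connected_Compl:
  assumes "L \<subseteq> K" shows "connected (- L)"
proof -
  define c where "c = (1 + norm I) * norm D"
  have c: "c \<ge> 0" by (simp add: c_def)
  define p where "p = \<i> * of_real (1 + c)"
  have "norm (p\<^sup>2) = (1 + c)\<^sup>2" using c by (simp add: p_def norm_mult norm_power del: of_real_add)
  then have "c < norm (p\<^sup>2)" using c by (simp add: power2_eq_square algebra_simps add_pos_nonneg)
  then have "p \<notin> K" unfolding K_def c_def using has_bounded_inverse_large by blast
  then show ?thesis
    using connected_complement_imaginary[of L p] assms K_imaginary by (auto simp: p_def)
qed

lemma Res_op_holomorphic: "op_holomorphic Res (- K)"
proof -
  have "op_holomorphic (\<lambda>w. binv ((csc w o\<^sub>L id_blinfun) + D)) {w. has_bounded_inverse ((csc w o\<^sub>L id_blinfun) + D)}"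
    by (rule op_holomorphic_pencil) (auto simp: I_D)
  then have "op_holomorphic (\<lambda>z. binv ((csc (z\<^sup>2) o\<^sub>L id_blinfun) + D)) (- K)"
    by (rule op_holomorphic_compose) (auto intro!: holomorphic_intros simp: K_def)
  then show ?thesis by (simp add: Res_def[abs_def])
qed

lemma Res_intertwine:
  assumes "p \<notin> K" "q \<notin> K" "W o\<^sub>L csc (p\<^sup>2) = csc (q\<^sup>2) o\<^sub>L W" "W o\<^sub>L D = D o\<^sub>L W"
  shows "W o\<^sub>L Res p = Res q o\<^sub>L W"
  unfolding Res_def by (rule binv_intertwine) (use assms(1,2) in \<open>simp_all add: K_def blinfun_compose_simps assms(3,4)\<close>)

lemma csc_Res_holomorphic: "op_holomorphic (\<lambda>z. csc z o\<^sub>L Res z) (- K)"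
  by (rule op_holomorphic_mult_csc[OF Res_op_holomorphic holomorphic_on_ident])

lemma cfun_Res_holomorphic: "cfun \<Phi> \<Longrightarrow> (\<lambda>z. \<Phi> (Res z)) holomorphic_on - K"
  using Res_op_holomorphic by (simp add: op_holomorphic_def)

section \<open>Cycles off \<open>K\<close> and the Riesz operator\<close>

definition cycle :: "(real \<Rightarrow> complex) list \<Rightarrow> bool" where
  "cycle \<Gamma> \<longleftrightarrow> (\<forall>\<gamma>\<in>set \<Gamma>. valid_path \<gamma> \<and> pathfinish \<gamma> = pathstart \<gamma> \<and> path_image \<gamma> \<subseteq> - K)"

lemma cycleD:
  assumes "cycle \<Gamma>" "\<gamma> \<in> set \<Gamma>"
  shows "valid_path \<gamma>" "pathfinish \<gamma> = pathstart \<gamma>" "path_image \<gamma> \<subseteq> - K"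
    and "p \<in> path_image \<gamma> \<Longrightarrow> p \<notin> K"
  using assms unfolding cycle_def by blast+

definition wind :: "(real \<Rightarrow> complex) list \<Rightarrow> complex \<Rightarrow> complex" where
  "wind \<Gamma> z = (\<Sum>\<gamma>\<leftarrow>\<Gamma>. winding_number \<gamma> z)"

definition riesz :: "(real \<Rightarrow> complex) list \<Rightarrow> 'y \<Rightarrow>\<^sub>L 'y" where
  "riesz \<Gamma> = csc (1 / (2 * pi * \<i>)) o\<^sub>L op_integral (\<lambda>z. csc z o\<^sub>L Res z) \<Gamma>"

lemma cfun_riesz:
  assumes "cycle \<Gamma>" "cfun \<Phi>"
  shows "\<Phi> (riesz \<Gamma>) = 1 / (2 * pi * \<i>) * (\<Sum>\<gamma>\<leftarrow>\<Gamma>. contour_integral \<gamma> (\<lambda>p. p * \<Phi> (Res p)))"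
proof -
  have "\<Phi> (op_integral (\<lambda>z. csc z o\<^sub>L Res z) \<Gamma>)
      = (\<Sum>\<gamma>\<leftarrow>\<Gamma>. contour_integral \<gamma> (\<lambda>z. \<Phi> (csc z o\<^sub>L Res z)))"
    by (rule cfun_op_integral[OF open_Compl_K csc_Res_holomorphic _ assms(2)])
      (use cycleD[OF assms(1)] in blast)
  then show ?thesis unfolding riesz_def cfun_csc[OF assms(2)] by simp
qed

lemma Cauchy_theorem_cycle_K:
  assumes f: "f holomorphic_on - K" and \<Gamma>: "cycle \<Gamma>" and zero: "\<And>z. z \<in> K \<Longrightarrow> wind \<Gamma> z = 0"
  shows "(\<Sum>\<gamma>\<leftarrow>\<Gamma>. contour_integral \<gamma> f) = 0"
proof (rule Cauchy_theorem_cycle[OF open_Compl_K connected_Compl[OF subset_refl] f])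
  show "valid_path \<gamma> \<and> pathfinish \<gamma> = pathstart \<gamma> \<and> path_image \<gamma> \<subseteq> - K" if "\<gamma> \<in> set \<Gamma>" for \<gamma>
    using cycleD[OF \<Gamma> that] by blast
  show "(\<Sum>\<gamma>\<leftarrow>\<Gamma>. winding_number \<gamma> w) = 0" if "w \<notin> - K" for w
    using zero[of w] that by (simp add: wind_def)
qed

text \<open>Adjoining the reversed paths of \<open>\<Delta>\<close> to \<open>\<Gamma>\<close> gives
  a cycle with winding number zero about every point of \<open>K\<close>.\<close>

lemma riesz_eq:
  assumes \<Gamma>: "cycle \<Gamma>" and \<Delta>: "cycle \<Delta>" and wind: "\<And>z. z \<in> K \<Longrightarrow> wind \<Gamma> z = wind \<Delta> z"
  shows "riesz \<Gamma> = riesz \<Delta>"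
proof (rule cfun_separates)
  fix \<Phi> assume \<Phi>: "cfun \<Phi>"
  define f where "f = (\<lambda>p. p * \<Phi> (Res p))"
  have f: "f holomorphic_on - K"
    unfolding f_def using \<Phi> by (intro holomorphic_intros cfun_Res_holomorphic)
  have rev: "(\<Sum>\<gamma>\<leftarrow>map reversepath xs. g \<gamma>) = - (\<Sum>\<gamma>\<leftarrow>xs. g \<gamma>)"
    if "\<And>\<gamma>. \<gamma> \<in> set xs \<Longrightarrow> g (reversepath \<gamma>) = - g \<gamma>" for g :: "(real \<Rightarrow> complex) \<Rightarrow> complex" and xs
    using that by (induction xs) auto
  have "(\<Sum>\<gamma>\<leftarrow>\<Gamma> @ map reversepath \<Delta>. contour_integral \<gamma> f) = 0"
  proof (rule Cauchy_theorem_cycle_K[OF f])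
    show "cycle (\<Gamma> @ map reversepath \<Delta>)" 
      using cycleD(1-3)[OF \<Gamma>] cycleD(1-3)[OF \<Delta>] by (fastforce simp: cycle_def)
    fix z assume z: "z \<in> K"
    have "(\<Sum>\<gamma>\<leftarrow>map reversepath \<Delta>. winding_number \<gamma> z) = - (\<Sum>\<gamma>\<leftarrow>\<Delta>. winding_number \<gamma> z)"
      by (intro rev winding_number_reversepath) (use cycleD[OF \<Delta>] z in \<open>auto simp: valid_path_imp_path\<close>)
    then show "wind (\<Gamma> @ map reversepath \<Delta>) z = 0"
      using wind[OF z] by (simp add: wind_def)
  qed
  moreover have "(\<Sum>\<gamma>\<leftarrow>map reversepath \<Delta>. contour_integral \<gamma> f) = - (\<Sum>\<gamma>\<leftarrow>\<Delta>. contour_integral \<gamma> f)"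
    by (intro rev contour_integral_reversepath cycleD(1)[OF \<Delta>])
  ultimately have "(\<Sum>\<gamma>\<leftarrow>\<Gamma>. contour_integral \<gamma> f) = (\<Sum>\<gamma>\<leftarrow>\<Delta>. contour_integral \<gamma> f)" by simp
  then show "\<Phi> (riesz \<Gamma>) = \<Phi> (riesz \<Delta>)"
    unfolding cfun_riesz[OF \<Gamma> \<Phi>] cfun_riesz[OF \<Delta> \<Phi>] f_def by simp
qed

section \<open>Commutation with operators that commute with \<open>D\<close>\<close>

lemma riesz_commute_linear:
  assumes \<Gamma>: "cycle \<Gamma>" and W: "I o\<^sub>L W = W o\<^sub>L I" "W o\<^sub>L D = D o\<^sub>L W"
  shows "W o\<^sub>L riesz \<Gamma> = riesz \<Gamma> o\<^sub>L W"
proof (rule cfun_separates)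
  fix \<Phi> assume \<Phi>: "cfun \<Phi>"
  have comm: "W o\<^sub>L Res p = Res p o\<^sub>L W" if "p \<notin> K" for p
    using that W by (intro Res_intertwine) (simp_all add: csc_commute)
  have "contour_integral \<gamma> (\<lambda>p. p * \<Phi> (W o\<^sub>L Res p)) = contour_integral \<gamma> (\<lambda>p. p * \<Phi> (Res p o\<^sub>L W))"
    if "\<gamma> \<in> set \<Gamma>" for \<gamma>
    by (rule contour_integral_eq) (use cycleD(4)[OF \<Gamma> that] comm in auto)
  then show "\<Phi> (W o\<^sub>L riesz \<Gamma>) = \<Phi> (riesz \<Gamma> o\<^sub>L W)"
    unfolding cfun_riesz[OF \<Gamma> cfun_compose_left[OF \<Phi> W(1)]] cfun_riesz[OF \<Gamma> cfun_compose_right[OF \<Phi>]]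
    by (simp cong: map_cong)
qed

text \<open>Moving \<open>W\<close> across the integral conjugates scalars, resolvent points and the
  path. The result is minus the integral over the conjugate cycle, which by \<open>sym\<close> winds
  about \<open>K\<close> oppositely to \<open>\<Gamma>\<close>, so the two signs cancel.\<close>

lemma riesz_commute_antilinear:
  assumes \<Gamma>: "cycle \<Gamma>" and W: "I o\<^sub>L W = - (W o\<^sub>L I)" "W o\<^sub>L D = D o\<^sub>L W"
    and sym: "\<And>z. z \<in> K \<Longrightarrow> wind \<Gamma> (cnj z) = cnj (wind \<Gamma> z)"
  shows "W o\<^sub>L riesz \<Gamma> = riesz \<Gamma> o\<^sub>L W"
proof (rule cfun_separates)
  fix \<Phi> assume \<Phi>: "cfun \<Phi>"
  interpret \<Phi>: bounded_linear \<Phi> using \<Phi> by (rule cfun_bounded_linear)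
  define \<xi> where "\<xi> = (\<lambda>p. p * \<Phi> (Res p o\<^sub>L W))"
  \<comment> \<open>Composition with an antilinear \<open>W\<close> makes the functional
    conjugate-linear; the outer \<open>cnj\<close> restores linearity.\<close>
  define \<Psi> where "\<Psi> = (\<lambda>a. cnj (\<Phi> (W o\<^sub>L a)))"
  have W_I: "W o\<^sub>L (I o\<^sub>L a) = - (I o\<^sub>L (W o\<^sub>L a))" for a
  proof -
    have "I o\<^sub>L (W o\<^sub>L a) = (I o\<^sub>L W) o\<^sub>L a" by (simp only: blinfun_compose_assoc)
    also have "\<dots> = - (W o\<^sub>L (I o\<^sub>L a))" unfolding W(1) by (simp add: blinfun_compose_simps blinfun_compose_assoc)
    finally show ?thesis by simp
  qed
  have "\<Psi> (I o\<^sub>L a) = \<i> * \<Psi> a" for a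
    using \<Phi> unfolding \<Psi>_def W_I by (simp add: \<Phi>.neg cfun_def)
  moreover have "bounded_linear \<Psi>"
    unfolding \<Psi>_def by (intro bounded_linear_compose[OF bounded_linear_cnj] bounded_linear_compose[OF \<Phi>.bounded_linear_axioms]
        bounded_bilinear.bounded_linear_right[OF bounded_bilinear_blinfun_compose])
  ultimately have \<Psi>: "cfun \<Psi>" by (simp add: cfun_def)
  have W_csc: "W o\<^sub>L csc z = csc (cnj z) o\<^sub>L W" for z
    using W(1) by (simp add: csc_def blinfun_compose_simps)
  have W_Res: "W o\<^sub>L Res p = Res (cnj p) o\<^sub>L W" if "p \<notin> K" for p
    using that W W_csc[of "p\<^sup>2"] by (intro Res_intertwine) simp_all
  have \<xi>: "\<xi> holomorphic_on - K"
    unfolding \<xi>_def by (intro holomorphic_intros cfun_Res_holomorphic[OF cfun_compose_right[OF \<Phi>]])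
  have "contour_integral \<gamma> (\<lambda>p. p * \<Psi> (Res p)) = cnj (contour_integral (cnj \<circ> \<gamma>) \<xi>)" if \<gamma>: "\<gamma> \<in> set \<Gamma>" for \<gamma>
  proof -
    have "contour_integral \<gamma> (\<lambda>p. p * \<Psi> (Res p)) = contour_integral \<gamma> (cnj \<circ> \<xi> \<circ> cnj)"
      by (rule contour_integral_eq) (use cycleD(4)[OF \<Gamma> \<gamma>] in \<open>auto simp: \<xi>_def \<Psi>_def W_Res\<close>)
    also have "\<dots> = cnj (contour_integral (cnj \<circ> \<gamma>) \<xi>)"
      using cycleD(1)[OF \<Gamma> \<gamma>] by (subst contour_integral_cnj) auto
    finally show ?thesis .
  qed
  then have "\<Psi> (riesz \<Gamma>) = 1 / (2 * pi * \<i>) * (\<Sum>\<gamma>\<leftarrow>\<Gamma>. cnj (contour_integral (cnj \<circ> \<gamma>) \<xi>))"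
    unfolding cfun_riesz[OF \<Gamma> \<Psi>] by (simp cong: map_cong)
  also have "(\<Sum>\<gamma>\<leftarrow>\<Gamma>. cnj (contour_integral (cnj \<circ> \<gamma>) \<xi>)) = cnj (\<Sum>\<gamma>\<leftarrow>map ((\<circ>) cnj) \<Gamma>. contour_integral \<gamma> \<xi>)"
    by (induction \<Gamma>) auto
  finally have 1: "\<Phi> (W o\<^sub>L riesz \<Gamma>) = - 1 / (2 * pi * \<i>) * (\<Sum>\<gamma>\<leftarrow>map ((\<circ>) cnj) \<Gamma>. contour_integral \<gamma> \<xi>)"
    unfolding \<Psi>_def by (subst complex_cnj_cancel_iff[symmetric]) simp
  have 2: "\<Phi> (riesz \<Gamma> o\<^sub>L W) = 1 / (2 * pi * \<i>) * (\<Sum>\<gamma>\<leftarrow>\<Gamma>. contour_integral \<gamma> \<xi>)"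
    unfolding cfun_riesz[OF \<Gamma> cfun_compose_right[OF \<Phi>]] \<xi>_def by simp
  have "(\<Sum>\<gamma>\<leftarrow>\<Gamma> @ map ((\<circ>) cnj) \<Gamma>. contour_integral \<gamma> \<xi>) = 0"
  proof (rule Cauchy_theorem_cycle_K[OF \<xi>])
    have "path_image (cnj \<circ> \<gamma>) \<subseteq> - K" if "path_image \<gamma> \<subseteq> - K" for \<gamma>
      using that by (auto simp: path_image_compose)
    then show "cycle (\<Gamma> @ map ((\<circ>) cnj) \<Gamma>)"
      using \<Gamma> by (auto simp: cycle_def valid_path_cnj pathstart_compose pathfinish_compose)
    fix z assume z: "z \<in> K"
    have "(\<Sum>\<gamma>\<leftarrow>map ((\<circ>) cnj) \<Delta>. winding_number \<gamma> z) = - cnj (\<Sum>\<gamma>\<leftarrow>\<Delta>. winding_number \<gamma> (cnj z))" if "cycle \<Delta>" for \<Delta>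
      using that
    proof (induction \<Delta>)
      case (Cons \<gamma> \<Delta>)
      then have "path \<gamma>" "cnj z \<notin> path_image \<gamma>" using z by (auto simp: cycle_def valid_path_imp_path)
      from winding_number_cnj[OF this] Cons show ?case by (simp add: cycle_def o_def)
    qed simp
    from this[OF \<Gamma>] show "wind (\<Gamma> @ map ((\<circ>) cnj) \<Gamma>) z = 0"
      using sym[OF z] by (simp add: wind_def)
  qed
  then have "(\<Sum>\<gamma>\<leftarrow>map ((\<circ>) cnj) \<Gamma>. contour_integral \<gamma> \<xi>) = - (\<Sum>\<gamma>\<leftarrow>\<Gamma>. contour_integral \<gamma> \<xi>)"
    by (simp add: eq_neg_iff_add_eq_0 add.commute)
  then show "\<Phi> (W o\<^sub>L riesz \<Gamma>) = \<Phi> (riesz \<Gamma> o\<^sub>L W)"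
    unfolding 1 2 by simp
qed

text \<open>No relation between \<open>W\<close> and \<open>I\<close> is assumed, which is what
  allows \<open>W = qop T\<close>.\<close>

theorem riesz_commute:
  assumes \<Gamma>: "cycle \<Gamma>" and W: "W o\<^sub>L D = D o\<^sub>L W"
    and sym: "\<And>z. z \<in> K \<Longrightarrow> wind \<Gamma> (cnj z) = cnj (wind \<Gamma> z)"
  shows "W o\<^sub>L riesz \<Gamma> = riesz \<Gamma> o\<^sub>L W"
proof -
  \<comment> \<open>As \<open>I^2 = - 1\<close>, the operators \<open>W - X\<close> and
    \<open>W + X\<close> are twice the linear and the antilinear part of \<open>W\<close>.\<close>
  define X where "X = I o\<^sub>L W o\<^sub>L I"
  have IX: "I o\<^sub>L X = - (W o\<^sub>L I)" and XI: "X o\<^sub>L I = - (I o\<^sub>L W)"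
  proof -
    have "I o\<^sub>L X = (I o\<^sub>L I) o\<^sub>L (W o\<^sub>L I)" unfolding X_def by (simp only: blinfun_compose_assoc)
    then show "I o\<^sub>L X = - (W o\<^sub>L I)" by (simp add: I_sq blinfun_compose_simps)
    have "X o\<^sub>L I = (I o\<^sub>L W) o\<^sub>L (I o\<^sub>L I)" unfolding X_def by (simp only: blinfun_compose_assoc)
    then show "X o\<^sub>L I = - (I o\<^sub>L W)" by (simp add: I_sq blinfun_compose_simps)
  qed
  have XD: "X o\<^sub>L D = D o\<^sub>L X"
    unfolding X_def by (rule HOL.sym) (intro blinfun_compose_commute, simp_all add: I_D W)
  define P where "P = riesz \<Gamma>"
  have 1: "(W - X) o\<^sub>L P = P o\<^sub>L (W - X)"
    unfolding P_def
    by (rule riesz_commute_linear[OF \<Gamma>]) (simp_all add: blinfun_compose_simps IX XI XD W)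
  have 2: "(W + X) o\<^sub>L P = P o\<^sub>L (W + X)"
    unfolding P_def
    by (rule riesz_commute_antilinear[OF \<Gamma> _ _ sym]) (simp_all add: blinfun_compose_simps IX XI XD W)
  have "W = (1 / 2) *\<^sub>R ((W - X) + (W + X))" by (simp add: scaleR_2[symmetric])
  then have "W o\<^sub>L P = P o\<^sub>L W"
    using 1 2 by (metis (no_types, lifting) blinfun_compose_simps(1,2,7,8))
  then show ?thesis by (simp add: P_def)
qed

text \<open>On \<open>V \<inter> - V\<close> the resolvent identity and Cauchy's formula extend \<open>(1 - P) Res\<close> holomorphically
  across \<open>K \<inter> V\<close>. Its only singularities are then in \<open>K - V\<close>, about which \<open>\<Gamma>\<close> does not wind.\<close>

theorem riesz_idempotent:
  assumes \<Gamma>: "cycle \<Gamma>" and V: "open V" "\<And>\<gamma>. \<gamma> \<in> set \<Gamma> \<Longrightarrow> path_image \<gamma> \<inter> V = {}"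
    and one: "\<And>z. z \<in> V \<Longrightarrow> wind \<Gamma> z = 1" and zero: "\<And>z. z \<in> K - V \<Longrightarrow> wind \<Gamma> z = 0"
    and sym: "\<And>z. z \<in> K \<inter> V \<Longrightarrow> - z \<in> V"
  shows "riesz \<Gamma> o\<^sub>L riesz \<Gamma> = riesz \<Gamma>"
proof (rule cfun_separates)
  fix \<Phi> assume \<Phi>: "cfun \<Phi>"
  interpret \<Phi>: bounded_linear \<Phi> using \<Phi> by (rule cfun_bounded_linear)
  define P where "P = riesz \<Gamma>"
  define c where "c = 1 / (2 * pi * \<i>)"
  have IP: "I o\<^sub>L (id_blinfun - P) = (id_blinfun - P) o\<^sub>L I"
    using riesz_commute_linear[OF \<Gamma>, of I] I_D by (simp add: P_def blinfun_compose_simps)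
  define \<Psi> where "\<Psi> = (\<lambda>a. \<Phi> ((id_blinfun - P) o\<^sub>L a))"
  have \<Psi>: "cfun \<Psi>" unfolding \<Psi>_def using \<Phi> IP by (rule cfun_compose_left)
  define h where "h = (\<lambda>p. \<Phi> (Res p))"
  have h: "h holomorphic_on - K" unfolding h_def using \<Phi> by (rule cfun_Res_holomorphic)
  define H where "H = (\<lambda>\<gamma> z. contour_integral \<gamma> (\<lambda>p. h p / (p - z)))"
  \<comment> \<open>For \<open>z\<close> in \<open>N - K\<close>, partial fractions give
    \<open>\<Phi> (P Res z) = h z - E z\<close>: the winding numbers 1 at both \<open>z\<close> and
    \<open>- z\<close> contribute half of \<open>h z\<close> each. Thus \<open>E\<close> agrees with
    \<open>\<Psi> (Res z)\<close> there, yet the Cauchy transforms are defined on \<open>K\<close>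
    as well.\<close>
  define E where "E = (\<lambda>z. c / 2 * (\<Sum>\<gamma>\<leftarrow>\<Gamma>. H \<gamma> z + H \<gamma> (- z)))"
  \<comment> \<open>Both poles \<open>z\<close> and \<open>- z\<close> of the partial fractions must
    lie in \<open>V\<close>.\<close>
  define N where "N = V \<inter> uminus -` V"
  have N: "open N" unfolding N_def using V(1)
    by (intro open_Int open_vimage) (auto intro!: continuous_intros)
  have E_hol: "E holomorphic_on N"
  proof -
    have "(\<lambda>z. H \<gamma> z + H \<gamma> (- z)) holomorphic_on N" if \<gamma>: "\<gamma> \<in> set \<Gamma>" for \<gamma>
    proof -
      have H: "H \<gamma> holomorphic_on - path_image \<gamma>"
        unfolding H_def using cycleD[OF \<Gamma> \<gamma>]
        by (intro cauchy_transform_holomorphic[OF h open_Compl_K])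
      have "N \<subseteq> - path_image \<gamma>" "uminus ` N \<subseteq> - path_image \<gamma>" using V(2)[OF \<gamma>] by (auto simp: N_def)
      then show ?thesis
        using holomorphic_on_compose_gen[OF holomorphic_on_minus[OF holomorphic_on_ident] H, of N]
        by (intro holomorphic_on_add holomorphic_on_subset[OF H]) (auto simp: o_def)
    qed
    then show ?thesis unfolding E_def by (intro holomorphic_on_mult holomorphic_on_const holomorphic_on_sum_list)
  qed
  have ext: "\<Psi> (Res z) = E z" if z: "z \<in> N - K" for z
  proof -
    have zV: "z \<in> V" "- z \<in> V" "z \<notin> K" using z by (auto simp: N_def)
    have "contour_integral \<gamma> (\<lambda>p. p * \<Phi> (Res p o\<^sub>L Res z))
        = - (1/2) * (H \<gamma> z + H \<gamma> (- z)) + (h z / 2) * (2 * pi * \<i>) * (winding_number \<gamma> z + winding_number \<gamma> (- z))"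
      if \<gamma>: "\<gamma> \<in> set \<Gamma>" for \<gamma>
    proof -
      have g: "valid_path \<gamma>" "path_image \<gamma> \<subseteq> - K" using cycleD[OF \<Gamma> \<gamma>] by auto
      have nz: "z \<notin> path_image \<gamma>" "- z \<notin> path_image \<gamma>" using V(2)[OF \<gamma>] zV by auto
      have pw: "p * \<Phi> (Res p o\<^sub>L Res z)
          = - (1/2) * (h p / (p - z)) + - (1/2) * (h p / (p - - z)) + ((h z / 2) * (1 / (p - z)) + (h z / 2) * (1 / (p - - z)))"
        if p: "p \<in> path_image \<gamma>" for p
      proof -
        have pK: "p \<notin> K" and ne: "p - z \<noteq> 0" "p + z \<noteq> 0" using p g nz by (auto simp: eq_neg_iff_add_eq_0[symmetric])
        have "Res p - Res z = Res p o\<^sub>L (csc (z\<^sup>2) + D - (csc (p\<^sup>2) + D)) o\<^sub>L Res z"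
          unfolding Res_def by (rule binv_diff) (use pK zV in \<open>auto simp: K_def\<close>)
        also have "csc (z\<^sup>2) + D - (csc (p\<^sup>2) + D) = csc (z\<^sup>2 - p\<^sup>2)" by (simp add: csc_diff)
        also have "Res p o\<^sub>L csc (z\<^sup>2 - p\<^sup>2) = csc (z\<^sup>2 - p\<^sup>2) o\<^sub>L Res p"
          using csc_commute[OF Res_intertwine[OF pK pK, of I]] csc_commute[of I "p\<^sup>2"] I_D by simp
        finally have "\<Phi> (Res p - Res z) = (z\<^sup>2 - p\<^sup>2) * \<Phi> (Res p o\<^sub>L Res z)"
          by (simp add: blinfun_compose_assoc cfun_csc[OF \<Phi>])
        then have "h p - h z = (z\<^sup>2 - p\<^sup>2) * \<Phi> (Res p o\<^sub>L Res z)" by (simp add: h_def \<Phi>.diff)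
        then have "\<Phi> (Res p o\<^sub>L Res z) * ((p - z) * (p + z)) = h z - h p"
          by (simp add: power2_eq_square algebra_simps)
        then show ?thesis by (rule partial_fractions_pm[OF ne])
      qed
      have i: "(\<lambda>p. h p / (p - w)) contour_integrable_on \<gamma>"
        if "w \<notin> path_image \<gamma>" for w
      proof -
        have w: "open (- K - {w})" "path_image \<gamma> \<subseteq> - K - {w}" using open_Compl_K g that by auto
        have "(\<lambda>p. h p / (p - w)) holomorphic_on - K - {w}"
          by (intro holomorphic_intros holomorphic_on_subset[OF h]) auto
        then show "(\<lambda>p. h p / (p - w)) contour_integrable_on \<gamma>"
          by (rule contour_integrable_holomorphic_simple[OF _ w(1) g(1) w(2)])
      qed
      have wn: "((\<lambda>p. 1 / (p - w)) has_contour_integral (2 * pi * \<i> * winding_number \<gamma> w)) \<gamma>"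
        if "w \<notin> path_image \<gamma>" for w
        using has_contour_integral_winding_number[OF g(1) that] .
      have Hi: "((\<lambda>p. h p / (p - w)) has_contour_integral H \<gamma> w) \<gamma>" if "w \<notin> path_image \<gamma>" for w
        unfolding H_def using i[OF that] by (rule has_contour_integral_integral)
      have "((\<lambda>p. - (1/2) * (h p / (p - z)) + - (1/2) * (h p / (p - - z)) + ((h z / 2) * (1 / (p - z)) + (h z / 2) * (1 / (p - - z))))
         has_contour_integral (- (1/2) * H \<gamma> z + - (1/2) * H \<gamma> (- z) +
           ((h z / 2) * (2 * pi * \<i> * winding_number \<gamma> z) + (h z / 2) * (2 * pi * \<i> * winding_number \<gamma> (- z))))) \<gamma>"
        by (intro has_contour_integral_add has_contour_integral_lmul Hi wn nz)
      then have "((\<lambda>p. p * \<Phi> (Res p o\<^sub>L Res z)) has_contour_integral (- (1/2) * H \<gamma> z + - (1/2) * H \<gamma> (- z) +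
           ((h z / 2) * (2 * pi * \<i> * winding_number \<gamma> z) + (h z / 2) * (2 * pi * \<i> * winding_number \<gamma> (- z))))) \<gamma>"
        by (rule has_contour_integral_eq) (simp add: pw)
      then show ?thesis by (simp add: contour_integral_unique algebra_simps)
    qed
    then have "\<Phi> (P o\<^sub>L Res z) = c * (\<Sum>\<gamma>\<leftarrow>\<Gamma>. - (1/2) * (H \<gamma> z + H \<gamma> (- z)) + (h z / 2) * (2 * pi * \<i>) * (winding_number \<gamma> z + winding_number \<gamma> (- z)))"
      unfolding P_def c_def cfun_riesz[OF \<Gamma> cfun_compose_right[OF \<Phi>]] by (simp cong: map_cong)
    also have "\<dots> = - (c / 2) * (\<Sum>\<gamma>\<leftarrow>\<Gamma>. H \<gamma> z + H \<gamma> (- z)) + c * ((h z / 2) * (2 * pi * \<i>) * (wind \<Gamma> z + wind \<Gamma> (- z)))"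
      unfolding wind_def by (induction \<Gamma>) (auto simp: algebra_simps)
    also have "\<dots> = h z - E z"
      using one zV by (simp add: E_def c_def mult_ac)
    finally show ?thesis by (simp add: \<Psi>_def h_def blinfun_compose_simps \<Phi>.diff)
  qed
  define g where "g = (\<lambda>z. if z \<in> N then E z else \<Psi> (Res z))"
  have g_K: "g z = \<Psi> (Res z)" if "z \<notin> K" for z using ext that by (auto simp: g_def)
  have "g holomorphic_on N \<union> - K"
  proof (rule holomorphic_on_Un)
    show "g holomorphic_on N" using E_hol by (rule holomorphic_transform) (simp add: g_def)
    show "g holomorphic_on - K" using cfun_Res_holomorphic[OF \<Psi>] by (rule holomorphic_transform) (simp add: g_K)
  qed (use N open_Compl_K in auto)
  \<comment> \<open>By \<open>sym\<close>, every point of \<open>K\<close> in \<open>V\<close> also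
    lies in \<open>N\<close>, so all singularities there are removed.\<close>
  moreover have "N \<union> - K = - (K - V)" using sym by (auto simp: N_def)
  ultimately have g: "(\<lambda>p. p * g p) holomorphic_on - (K - V)" by (auto intro: holomorphic_intros)
  have "(\<Sum>\<gamma>\<leftarrow>\<Gamma>. contour_integral \<gamma> (\<lambda>p. p * g p)) = 0"
  proof (rule Cauchy_theorem_cycle[OF _ connected_Compl[OF Diff_subset] g])
    show "open (- (K - V))" using \<open>N \<union> - K = - (K - V)\<close> N open_Compl_K by (metis open_Un)
    show "valid_path \<gamma> \<and> pathfinish \<gamma> = pathstart \<gamma> \<and> path_image \<gamma> \<subseteq> - (K - V)" if "\<gamma> \<in> set \<Gamma>" for \<gamma>
      using cycleD[OF \<Gamma> that] by blast
    show "(\<Sum>\<gamma>\<leftarrow>\<Gamma>. winding_number \<gamma> w) = 0" if "w \<notin> - (K - V)" for w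
      using zero[of w] that by (simp add: wind_def)
  qed
  moreover have "contour_integral \<gamma> (\<lambda>p. p * g p) = contour_integral \<gamma> (\<lambda>p. p * \<Psi> (Res p))" if "\<gamma> \<in> set \<Gamma>" for \<gamma>
    by (rule contour_integral_eq) (use cycleD(4)[OF \<Gamma> that] in \<open>auto simp: g_K\<close>)
  \<comment> \<open>This says that \<open>\<Phi>\<close> vanishes on
    \<open>(1 - P) P\<close>.\<close>
  ultimately have "\<Psi> P = 0"
    unfolding P_def cfun_riesz[OF \<Gamma> \<Psi>] by (simp cong: map_cong)
  then show "\<Phi> (riesz \<Gamma> o\<^sub>L riesz \<Gamma>) = \<Phi> (riesz \<Gamma>)"
    by (simp add: \<Psi>_def P_def blinfun_compose_simps \<Phi>.diff)
qed

end

section \<open>Quaternionic operators\<close>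

lemmas components = c0_def c1_def c2_def c3_def

lemma qscal_apply:
  "qscal q x =
    (c0 q *\<^sub>R c0 x - c1 q *\<^sub>R c1 x - c2 q *\<^sub>R c2 x - c3 q *\<^sub>R c3 x,
     c0 q *\<^sub>R c1 x + c1 q *\<^sub>R c0 x + c2 q *\<^sub>R c3 x - c3 q *\<^sub>R c2 x,
     c0 q *\<^sub>R c2 x - c1 q *\<^sub>R c3 x + c2 q *\<^sub>R c0 x + c3 q *\<^sub>R c1 x,
     c0 q *\<^sub>R c3 x + c1 q *\<^sub>R c2 x - c2 q *\<^sub>R c1 x + c3 q *\<^sub>R c0 x)"
  by (simp add: qscal_def qop_apply qop_fun_def components blinfun.bilinear_simps)

lemma qscal_mult: "qscal (p \<star> q) = qscal p o\<^sub>L qscal q"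
  by (rule blinfun_eqI) (simp add: qscal_apply qmult_def components algebra_simps)

lemma qscal_add: "qscal (p + q) = qscal p + qscal q"
  by (rule blinfun_eqI) (simp add: qscal_apply blinfun.bilinear_simps components algebra_simps)

lemma qscal_scaleR: "qscal (r *\<^sub>R q) = r *\<^sub>R qscal q"
  by (rule blinfun_eqI) (simp add: qscal_apply blinfun.bilinear_simps components algebra_simps)

lemma qscal_real: "qscal (r, 0, 0, 0) = r *\<^sub>R id_blinfun"
  by (rule blinfun_eqI) (simp add: qscal_apply blinfun.bilinear_simps components prod_eq_iff)

lemma qscal_minus: "qscal (- q) = - qscal q"
  using qscal_scaleR[of "-1" q] by simp

lemma complex_structure_qscal:
  assumes "J \<in> SS" shows "complex_structure (qscal J :: 'x::banach qmod \<Rightarrow>\<^sub>L 'x qmod)"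
proof
  have "qscal J o\<^sub>L qscal J = (qscal (J \<star> J) :: 'x qmod \<Rightarrow>\<^sub>L 'x qmod)"
    by (rule qscal_mult[symmetric])
  also have "J \<star> J = (-1, 0, 0, 0)"
    using assms by (simp add: SS_def qmult_def power2_eq_square algebra_simps)
  finally show "qscal J o\<^sub>L qscal J = - (id_blinfun :: 'x qmod \<Rightarrow>\<^sub>L 'x qmod)"
    by (simp add: qscal_real)
qed

section \<open>Operators acting componentwise\<close>

definition diag :: "('x::real_normed_vector \<Rightarrow>\<^sub>L 'x) \<Rightarrow> 'x qmod \<Rightarrow>\<^sub>L 'x qmod" where
  "diag A = qop (A, 0, 0, 0)"

lemma diag_apply: "diag A x = (A (c0 x), A (c1 x), A (c2 x), A (c3 x))"
  by (simp add: diag_def qop_apply qop_fun_def components)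

lemma diag_compose: "diag (A o\<^sub>L B) = diag A o\<^sub>L diag B"
  by (rule blinfun_eqI) (simp add: diag_apply components)

lemma diag_add: "diag (A + B) = diag A + diag B"
  by (rule blinfun_eqI) (simp add: diag_apply components blinfun.bilinear_simps)

lemma diag_diff: "diag (A - B) = diag A - diag B"
  by (rule blinfun_eqI) (simp add: diag_apply components blinfun.bilinear_simps)

lemma diag_scaleR: "diag (r *\<^sub>R A) = r *\<^sub>R diag A"
  by (rule blinfun_eqI) (simp add: diag_apply components blinfun.bilinear_simps)

lemma diag_id: "diag id_blinfun = id_blinfun"
  by (rule blinfun_eqI) (simp add: diag_apply components)

lemma qscal_diag: "qscal q o\<^sub>L diag A = diag A o\<^sub>L qscal q"
  by (rule blinfun_eqI) (simp add: diag_apply qscal_apply components blinfun.bilinear_simps)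

lemma has_bounded_inverse_diag:
  assumes "has_bounded_inverse A" shows "has_bounded_inverse (diag A)"
  by (rule has_bounded_inverseI[of "diag (binv A)"])
    (simp_all add: diag_id binv[OF assms] flip: diag_compose)

text \<open>The linear term vanishes because the real component of \<open>T\<close> is zero. In
  \<open>T\<close> times its conjugate the mixed terms cancel, since the units anticommute while the
  components commute.\<close>

lemma Qcs_imaginary:
  assumes comm: "T1 o\<^sub>L T2 = T2 o\<^sub>L T1" "T1 o\<^sub>L T3 = T3 o\<^sub>L T1" "T2 o\<^sub>L T3 = T3 o\<^sub>L T2"
  shows "Qcs (0, T1, T2, T3) s =
    (qscal s o\<^sub>L qscal s) + diag ((T1 o\<^sub>L T1) + (T2 o\<^sub>L T2) + (T3 o\<^sub>L T3))"
proof -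
  have c: "T1 (T2 x) = T2 (T1 x)" "T1 (T3 x) = T3 (T1 x)" "T2 (T3 x) = T3 (T2 x)" for x
    using comm by (metis blinfun_apply_blinfun_compose)+
  have "qop (0, T1, T2, T3) + qop (qconjop (0, T1, T2, T3)) = 0"
    by (rule blinfun_eqI) (simp add: qop_apply qop_fun_def qconjop_def components blinfun.bilinear_simps zero_prod_def)
  moreover have "qop (0, T1, T2, T3) o\<^sub>L qop (qconjop (0, T1, T2, T3))
      = diag ((T1 o\<^sub>L T1) + (T2 o\<^sub>L T2) + (T3 o\<^sub>L T3))"
    by (rule blinfun_eqI)
      (simp add: qop_apply qop_fun_def qconjop_def diag_apply components blinfun.bilinear_simps c algebra_simps)
  ultimately show ?thesis by (simp add: Qcs_def qscal_mult)
qed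

lemma qop_diag_commute:
  assumes "\<And>B. B \<in> {c0 T, c1 T, c2 T, c3 T} \<Longrightarrow> B o\<^sub>L A = A o\<^sub>L B"
  shows "qop T o\<^sub>L diag A = diag A o\<^sub>L qop T"
proof -
  have "B (A x) = A (B x)" if "B \<in> {c0 T, c1 T, c2 T, c3 T}" for B x
    using assms[OF that] by (metis blinfun_apply_blinfun_compose)
  then show ?thesis
    by (intro blinfun_eqI) (simp add: qop_apply qop_fun_def diag_apply blinfun.bilinear_simps, simp add: components blinfun.bilinear_simps)
qed

lemma cshift_apply: "cshift A l p = cshift_fun A l p"
  by (simp add: cshift_def bounded_linear_Blinfun_apply bounded_linear_cshift_fun)

text \<open>\<open>(A - l)(A - cnj l) = (A - Re l)\<^sup>2 + (Im l)\<^sup>2\<close> acts componentwise on the complexification.\<close>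

lemma real_spectrum_quadratic:
  fixes A :: "'x::real_normed_vector \<Rightarrow>\<^sub>L 'x" and a b :: real
  assumes A: "cspectrum A \<subseteq> \<real>" and b: "b \<noteq> 0"
  defines "N \<equiv> ((A - a *\<^sub>R id_blinfun) o\<^sub>L (A - a *\<^sub>R id_blinfun)) + b\<^sup>2 *\<^sub>R id_blinfun"
  shows "has_bounded_inverse N"
proof -
  have "has_bounded_inverse (cshift A l)" if "Im l \<noteq> 0" for l
    using A that by (auto simp: cspectrum_def complex_is_Real_iff)
  then have inv: "has_bounded_inverse (cshift A (Complex a b) o\<^sub>L cshift A (Complex a (- b)))"
    using b by (intro has_bounded_inverse_compose) auto
  have S: "(cshift A (Complex a b) o\<^sub>L cshift A (Complex a (- b))) p = (N (fst p), N (snd p))" for p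
    by (simp add: cshift_apply cshift_fun_def N_def blinfun.bilinear_simps power2_eq_square algebra_simps)
  define B where "B = binv (cshift A (Complex a b) o\<^sub>L cshift A (Complex a (- b)))"
  have BS: "B (N x, N y) = (x, y)" for x y
    using arg_cong[OF binv(1)[OF inv], of "\<lambda>X. X (x, y)"] S[of "(x, y)"] by (simp add: B_def)
  have SB: "(N (fst (B p)), N (snd (B p))) = p" for p
    using arg_cong[OF binv(2)[OF inv], of "\<lambda>X. X p"] S[of "B p"] by (simp add: B_def)
  \<comment> \<open>The product acts as \<open>N\<close> on each component, so compressing its
    inverse to the first component inverts \<open>N\<close>.\<close>
  define C where "C = Blinfun (\<lambda>x. fst (B (x, 0)))"
  have C: "C x = fst (B (x, 0))" for x
    unfolding C_def
    by (subst bounded_linear_Blinfun_apply)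
      (auto intro!: bounded_linear_compose[OF bounded_linear_fst] bounded_linear_compose[OF blinfun.bounded_linear_right]
        bounded_linear_Pair bounded_linear_ident bounded_linear_zero)
  show ?thesis
  proof (rule has_bounded_inverseI[of C])
    show "C o\<^sub>L N = id_blinfun"
    proof (rule blinfun_eqI)
      fix x show "(C o\<^sub>L N) x = id_blinfun x"
        using BS[of x 0] by (simp add: C)
    qed
    show "N o\<^sub>L C = id_blinfun"
    proof (rule blinfun_eqI)
      fix x show "(N o\<^sub>L C) x = id_blinfun x"
        using arg_cong[OF SB[of "(x, 0)"], of fst] by (simp add: C)
    qed
  qed
qed

text \<open>The spectrum of \<open>A\<close> is defined on the complexification of the real space,
  whereas here the imaginary unit is \<open>qscal J\<close> on the quaternionic module. The product
  of \<open>\<mu> + A\<close> and \<open>cnj \<mu> + A\<close> has real coefficients and acts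
  componentwise, so its invertibility passes from one setting to the other.\<close>

lemma nonneg_spectrum_diag_square:
  fixes A :: "'x::banach \<Rightarrow>\<^sub>L 'x"
  assumes J: "J \<in> SS" and A: "cspectrum A \<subseteq> \<real>"
  shows "complex_structure.nonneg_spectrum (qscal J) (diag A o\<^sub>L diag A)"
proof -
  interpret complex_structure "qscal J :: 'x qmod \<Rightarrow>\<^sub>L 'x qmod" using J by (rule complex_structure_qscal)
  show ?thesis
  proof (rule nonneg_spectrum_square)
    show "qscal J o\<^sub>L diag A = diag A o\<^sub>L qscal J" by (rule qscal_diag)
    fix \<mu> :: complex assume \<mu>: "Im \<mu> \<noteq> 0"
    define X where "X = csc \<mu> + diag A"
    define Y where "Y = csc (cnj \<mu>) + diag A"
    define a where "a = - Re \<mu>"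
    have cA: "csc z o\<^sub>L diag A = diag A o\<^sub>L csc z" for z by (rule csc_commute[OF qscal_diag])
    have XY: "X o\<^sub>L Y = Y o\<^sub>L X"
      unfolding X_def Y_def using csc_mult[of \<mu> "cnj \<mu>"] csc_mult[of "cnj \<mu>" \<mu>]
      by (simp add: blinfun_compose_simps cA mult.commute)
    have twice: "a *\<^sub>R diag A + a *\<^sub>R diag A = (a * 2) *\<^sub>R diag A" by (simp flip: scaleR_add_left)
    have "X o\<^sub>L Y = csc (\<mu> * cnj \<mu>) + (csc (\<mu> + cnj \<mu>) o\<^sub>L diag A) + (diag A o\<^sub>L diag A)"
      unfolding X_def Y_def by (simp add: csc_mult csc_add blinfun_compose_simps cA algebra_simps)
    also have "\<mu> * cnj \<mu> = of_real (a\<^sup>2 + (Im \<mu>)\<^sup>2)" by (simp add: a_def complex_mult_cnj)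
    also have "\<mu> + cnj \<mu> = of_real (- (a * 2))" by (simp add: a_def complex_add_cnj)
    finally have "X o\<^sub>L Y = diag (((A - a *\<^sub>R id_blinfun) o\<^sub>L (A - a *\<^sub>R id_blinfun)) + (Im \<mu>)\<^sup>2 *\<^sub>R id_blinfun)"
      unfolding csc_of_real
      by (simp add: twice diag_compose diag_add diag_diff diag_scaleR diag_id blinfun_compose_simps power2_eq_square algebra_simps)
    then have "has_bounded_inverse (X o\<^sub>L Y)"
      using has_bounded_inverse_diag[OF real_spectrum_quadratic[OF A \<mu>]] by simp
    then show "has_bounded_inverse (csc \<mu> + diag A)"
      using has_bounded_inverse_factor XY unfolding X_def by blast
  qed
qed

theorem theorem7p2:
  fixes T1 T2 T3 :: "'x::banach \<Rightarrow>\<^sub>L 'x"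
    and \<sigma>1 \<sigma>2 G1 G2 :: "quat set"
    and J :: quat
    and \<Gamma>1 \<Gamma>2 :: "(real \<Rightarrow> complex) list"
  assumes comm: "T1 o\<^sub>L T2 = T2 o\<^sub>L T1" "T1 o\<^sub>L T3 = T3 o\<^sub>L T1" "T2 o\<^sub>L T3 = T3 o\<^sub>L T2"
    and real_spec: "cspectrum T1 \<subseteq> \<real>" "cspectrum T2 \<subseteq> \<real>" "cspectrum T3 \<subseteq> \<real>"
    and split: "S_spectrum (0, T1, T2, T3) = \<sigma>1 \<union> \<sigma>2"
    and sep: "\<exists>\<delta>>0. \<forall>a\<in>\<sigma>1. \<forall>b\<in>\<sigma>2. \<delta> \<le> dist a b"
    and G1: "slice_cauchy_domain G1" "bounded G1"
    and G2: "slice_cauchy_domain G2" "bounded G2"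
    and incl: "\<sigma>1 \<subseteq> G1" "closure G1 \<subseteq> G2"
    and sep2: "\<exists>\<delta>>0. \<forall>a\<in>G2. \<forall>b\<in>\<sigma>2. \<delta> \<le> dist a b"
    and J: "J \<in> SS"
    and bd2: "pos_oriented_boundary (slice_part G2 J) \<Gamma>2"
    and bd1: "pos_oriented_boundary (slice_part G1 J) \<Gamma>1"
  shows "let T = (0, T1, T2, T3);
             L = (\<lambda>s ds. qscal (s \<star> ds) o\<^sub>L binv (Qcs T s));
             R = (\<lambda>p dp. binv (Qcs T p) o\<^sub>L qscal (dp \<star> p));
             P = (1 / (2 * pi)) *\<^sub>R qpath_integral J L \<Gamma>2
         in qpath_integrable J L \<Gamma>2 \<and> qpath_integrable J R \<Gamma>1 \<and>
            P = (1 / (2 * pi)) *\<^sub>R qpath_integral J R \<Gamma>1 \<and>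
            P o\<^sub>L P = P \<and>
            qop T o\<^sub>L P = P o\<^sub>L qop T"
proof -
  define D0 where "D0 = (T1 o\<^sub>L T1) + (T2 o\<^sub>L T2) + (T3 o\<^sub>L T3)"
  define D where "D = diag D0"
  define T where "T = (0 :: 'x \<Rightarrow>\<^sub>L 'x, T1, T2, T3)"
  have D_sum: "D = (diag T1 o\<^sub>L diag T1) + (diag T2 o\<^sub>L diag T2) + (diag T3 o\<^sub>L diag T3)"
    by (simp add: D_def D0_def diag_add diag_compose)
  have dc: "diag T1 o\<^sub>L diag T2 = diag T2 o\<^sub>L diag T1" "diag T1 o\<^sub>L diag T3 = diag T3 o\<^sub>L diag T1"
      "diag T2 o\<^sub>L diag T3 = diag T3 o\<^sub>L diag T2"
    using comm by (simp_all flip: diag_compose)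
  have sq: "(A o\<^sub>L A) o\<^sub>L (B o\<^sub>L B) = (B o\<^sub>L B) o\<^sub>L (A o\<^sub>L A)"
    if "A o\<^sub>L B = B o\<^sub>L A" for A B :: "'x qmod \<Rightarrow>\<^sub>L 'x qmod"
    by (intro blinfun_compose_commute blinfun_compose_commute[symmetric]) (simp_all add: that)
  interpret complex_structure "qscal J :: 'x qmod \<Rightarrow>\<^sub>L 'x qmod"
    using J by (rule complex_structure_qscal)
  note sqs = nonneg_spectrum_diag_square[OF J real_spec(1)] nonneg_spectrum_diag_square[OF J real_spec(2)]
      nonneg_spectrum_diag_square[OF J real_spec(3)]
  have "nonneg_spectrum ((diag T1 o\<^sub>L diag T1) + (diag T2 o\<^sub>L diag T2))"
    by (rule nonneg_spectrum_add[OF sqs(1,2) sq[OF dc(1)]])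
  then have "nonneg_spectrum D"
    unfolding D_sum
    by (rule nonneg_spectrum_add[OF _ sqs(3)]) (simp add: blinfun_compose_simps sq[OF dc(2)] sq[OF dc(3)])
  then interpret nonneg_operator "qscal J :: 'x qmod \<Rightarrow>\<^sub>L 'x qmod" D
    by unfold_locales
  have csc_slice: "qscal (sliceJ J z) = csc z" for z
    by (simp add: csc_def sliceJ_def qscal_add qscal_real qscal_scaleR)
  have csc_minus_J: "qscal (- J) = csc (- \<i>)"
    by (simp add: qscal_minus csc_minus)
  have Qcs: "Qcs T (sliceJ J z) = csc (z\<^sup>2) + D" for z
    unfolding T_def Qcs_imaginary[OF comm] D_def D0_def csc_slice by (simp add: power2_eq_square csc_mult)
  have K: "z \<in> K \<longleftrightarrow> sliceJ J z \<in> \<sigma>1 \<union> \<sigma>2" for z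
    unfolding split[symmetric] S_spectrum_def K_def T_def[symmetric] by (simp add: Qcs)

  \<comment> \<open>Position of \<open>K\<close> relative to the two planar domains\<close>
  define V1 where "V1 = slice_part G1 J"
  define V2 where "V2 = slice_part G2 J"
  have cont: "continuous_on UNIV (sliceJ J)"
    unfolding sliceJ_def by (intro continuous_intros)
  have open_slice: "open (slice_part G J)" if "open G" for G
  proof -
    have "slice_part G J = sliceJ J -` G" by (auto simp: slice_part_def)
    then show ?thesis using open_vimage[OF that cont] by simp
  qed
  have closure_slice: "closure (slice_part G J) \<subseteq> slice_part (closure G) J" for G
  proof -
    have "slice_part (closure G) J = sliceJ J -` closure G" by (auto simp: slice_part_def)
    moreover have "closed (sliceJ J -` closure G)" using closed_vimage[OF closed_closure cont] .
    ultimately have "closed (slice_part (closure G) J)" by simp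
    moreover have "slice_part G J \<subseteq> slice_part (closure G) J"
      using closure_subset by (auto simp: slice_part_def)
    ultimately show ?thesis by (rule closure_minimal[rotated])
  qed
  have V: "open V1" "open V2"
    unfolding V1_def V2_def using G1 G2 by (auto intro!: open_slice simp: slice_cauchy_domain_def)
  have V12: "closure V1 \<subseteq> V2"
    unfolding V1_def V2_def using closure_slice[of G1] incl(2) by (auto simp: slice_part_def)
  \<comment> \<open>This dichotomy, with \<open>V12\<close>, keeps both boundaries off
    \<open>K\<close> and makes every winding number about a point of \<open>K\<close> equal to 0 or
    1.\<close>
  have K_V: "z \<in> V1 \<or> z \<notin> closure V2" if z: "z \<in> K" for z
  proof (cases "sliceJ J z \<in> \<sigma>1")
    case True
    then show ?thesis using incl(1) by (auto simp: V1_def slice_part_def)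
  next
    case False
    then have "sliceJ J z \<in> \<sigma>2" using z K by blast
    then have "sliceJ J z \<notin> closure G2"
      using sep2 unfolding closure_approachable by (metis not_less)
    then show ?thesis using closure_slice[of G2] by (auto simp: V2_def slice_part_def)
  qed
  \<comment> \<open>Replacing \<open>J\<close> by \<open>- J\<close> conjugates the slice, so axial
    symmetry of \<open>G1\<close> gives invariance under conjugation, which is negation on
    \<open>K\<close>.\<close>
  have V1_cnj: "- z \<in> V1" if "z \<in> K" "z \<in> V1" for z
  proof -
    have mJ: "- J \<in> SS" using J by (simp add: SS_def components)
    have "sliceJ J (Complex (Re z) (Im z)) \<in> G1" using that by (simp add: V1_def slice_part_def)
    then have "sliceJ (- J) (Complex (Re z) (Im z)) \<in> G1"
      using G1(1) J mJ unfolding slice_cauchy_domain_def axially_symmetric_def by blast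
    moreover have "sliceJ (- J) (Complex (Re z) (Im z)) = sliceJ J (cnj z)"
      by (simp add: sliceJ_def)
    ultimately show ?thesis using K_cnj[OF that(1)] by (simp add: V1_def slice_part_def)
  qed

  have path_V1: "path_image \<gamma> \<inter> V1 = {}" if "\<gamma> \<in> set \<Gamma>1" for \<gamma>
  proof -
    have "path_image \<gamma> \<subseteq> frontier V1" using bd1 that unfolding pos_oriented_boundary_def V1_def by blast
    then show ?thesis using V(1) by (auto simp: frontier_def interior_open)
  qed
  have cyc1: "cycle \<Gamma>1" and cyc2: "cycle \<Gamma>2"
  proof -
    have "frontier V1 \<subseteq> - K" "frontier V2 \<subseteq> - K"
      using K_V V V12 closure_subset[of V1] closure_subset[of V2] by (auto simp: frontier_def interior_open)
    moreover have "cycle \<Gamma>" if "pos_oriented_boundary V \<Gamma>" "frontier V \<subseteq> - K" for V \<Gamma>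
      unfolding cycle_def
    proof (intro ballI conjI)
      fix \<gamma> assume \<gamma>: "\<gamma> \<in> set \<Gamma>"
      then show "valid_path \<gamma>" "pathfinish \<gamma> = pathstart \<gamma>"
        using that(1) by (simp_all add: pos_oriented_boundary_def jordan_family_def)
      have "path_image \<gamma> \<subseteq> frontier V"
        using that(1) \<gamma> by (auto simp: pos_oriented_boundary_def)
      then show "path_image \<gamma> \<subseteq> - K" using that(2) by (rule order_trans)
    qed
    ultimately show "cycle \<Gamma>1" "cycle \<Gamma>2"
      using bd1 bd2 unfolding V1_def V2_def by simp_all
  qed
  have wind1: "wind \<Gamma>1 z = 1" if "z \<in> V1" for z
    using bd1 that by (simp add: pos_oriented_boundary_def wind_def V1_def)
  have wind0: "wind \<Gamma>1 z = 0" if "z \<in> K - V1" for z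
  proof -
    have "z \<notin> closure V1" using K_V[of z] that V12 closure_subset[of V2] by blast
    then show ?thesis using bd1 by (simp add: pos_oriented_boundary_def wind_def V1_def)
  qed
  have wind_eq: "wind \<Gamma>2 z = wind \<Gamma>1 z" if z: "z \<in> K" for z
  proof (cases "z \<in> V1")
    case True
    then have "z \<in> V2" using V12 closure_subset[of V1] by blast
    then show ?thesis using bd2 wind1[OF True] by (simp add: pos_oriented_boundary_def wind_def V2_def)
  next
    case False
    then have "z \<notin> closure V2" using K_V[OF z] by blast
    then show ?thesis using bd2 wind0[of z] False z by (simp add: pos_oriented_boundary_def wind_def V2_def)
  qed
  have riesz_21: "riesz \<Gamma>2 = riesz \<Gamma>1" by (rule riesz_eq[OF cyc2 cyc1 wind_eq])
  have idem: "riesz \<Gamma>1 o\<^sub>L riesz \<Gamma>1 = riesz \<Gamma>1"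
    by (rule riesz_idempotent[OF cyc1 V(1) path_V1 wind1 wind0]) (use V1_cnj in auto)
  have commT: "qop T o\<^sub>L riesz \<Gamma>1 = riesz \<Gamma>1 o\<^sub>L qop T"
  proof (rule riesz_commute[OF cyc1])
    have c: "A o\<^sub>L (B o\<^sub>L B) = (B o\<^sub>L B) o\<^sub>L A" if "A o\<^sub>L B = B o\<^sub>L A" for A B :: "'x \<Rightarrow>\<^sub>L 'x"
      using that by (intro blinfun_compose_commute)
    have "B o\<^sub>L D0 = D0 o\<^sub>L B" if "B \<in> {0, T1, T2, T3}" for B
      using that by (auto simp: D0_def blinfun_compose_simps c comm)
    then show "qop T o\<^sub>L D = D o\<^sub>L qop T"
      unfolding D_def by (intro qop_diag_commute) (auto simp: T_def components)
    fix z assume z: "z \<in> K"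
    then have "cnj z \<in> V1 \<longleftrightarrow> z \<in> V1" using V1_cnj[of z] V1_cnj[of "- z"] by (auto simp: K_cnj)
    then show "wind \<Gamma>1 (cnj z) = cnj (wind \<Gamma>1 z)"
      using wind1[of z] wind1[of "cnj z"] wind0[of z] wind0[of "cnj z"] z by (cases "z \<in> V1") auto
  qed

  \<comment> \<open>Comparison of the quaternionic integrals with the Riesz operator\<close>
  define F where "F = (\<lambda>z. csc z o\<^sub>L Res z)"
  define L where "L = (\<lambda>s ds. qscal (s \<star> ds) o\<^sub>L binv (Qcs T s))"
  define R where "R = (\<lambda>p dp. binv (Qcs T p) o\<^sub>L qscal (dp \<star> p))"
  have bl: "bounded_linear ((o\<^sub>L) (csc (- \<i>)))"
    by (rule bounded_bilinear.bounded_linear_right[OF bounded_bilinear_blinfun_compose])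
  have L_eq: "qpath_integrand J L \<gamma> t = csc (- \<i>) o\<^sub>L op_integrand F \<gamma> t" for \<gamma> t
    unfolding qpath_integrand_def L_def op_integrand_def F_def Res_def Qcs qscal_mult csc_slice csc_minus_J
    by (simp add: mult_ac flip: csc_mult blinfun_compose_assoc)
  \<comment> \<open>Reordering the factors needs the inverse to commute with \<open>qscal J\<close>.
    This is available only off \<open>K\<close>; on \<open>K\<close> the value of
    \<open>binv\<close> is an arbitrary choice.\<close>
  have R_eq: "qpath_integrand J R \<gamma> t = csc (- \<i>) o\<^sub>L op_integrand F \<gamma> t" if "\<gamma> t \<notin> K" for \<gamma> t
  proof -
    have "qscal J o\<^sub>L Res (\<gamma> t) = Res (\<gamma> t) o\<^sub>L qscal J"
      using that csc_commute[of "qscal J" "(\<gamma> t)\<^sup>2"] I_D by (intro Res_intertwine) simp_all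
    note Res_csc = csc_commute[OF this, symmetric]
    show ?thesis
      unfolding qpath_integrand_def R_def op_integrand_def F_def Qcs Res_def[symmetric] qscal_mult csc_slice csc_minus_J
      by (simp add: mult_ac Res_csc flip: csc_mult blinfun_compose_assoc)
  qed
  have int: "(op_integrand F \<gamma> has_integral integral {0..1} (op_integrand F \<gamma>)) {0..1}"
    if "cycle \<Gamma>" "\<gamma> \<in> set \<Gamma>" for \<Gamma> \<gamma>
    unfolding F_def using cycleD[OF that]
    by (intro integrable_integral op_integrand_integrable[OF open_Compl_K csc_Res_holomorphic])
  have int': "((\<lambda>t. csc (- \<i>) o\<^sub>L op_integrand F \<gamma> t) has_integral (csc (- \<i>) o\<^sub>L integral {0..1} (op_integrand F \<gamma>))) {0..1}"
    if "cycle \<Gamma>" "\<gamma> \<in> set \<Gamma>" for \<Gamma> \<gamma>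
    using has_integral_linear[OF int[OF that] bl] by (simp add: o_def)
  have L_int: "(qpath_integrand J L \<gamma> has_integral (csc (- \<i>) o\<^sub>L integral {0..1} (op_integrand F \<gamma>))) {0..1}"
    if "\<gamma> \<in> set \<Gamma>2" for \<gamma>
    by (rule has_integral_eq[OF _ int'[OF cyc2 that]]) (simp add: L_eq)
  have R_int: "(qpath_integrand J R \<gamma> has_integral (csc (- \<i>) o\<^sub>L integral {0..1} (op_integrand F \<gamma>))) {0..1}"
    if "\<gamma> \<in> set \<Gamma>1" for \<gamma>
  proof (rule has_integral_eq[OF _ int'[OF cyc1 that]])
    fix t :: real assume "t \<in> {0..1}"
    then have "\<gamma> t \<notin> K" using cycleD(4)[OF cyc1 that, of "\<gamma> t"] by (simp add: path_image_def)
    then show "csc (- \<i>) o\<^sub>L op_integrand F \<gamma> t = qpath_integrand J R \<gamma> t" by (simp add: R_eq)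
  qed
  have riesz_sum: "riesz \<Gamma> = (1 / (2 * pi)) *\<^sub>R (\<Sum>\<gamma>\<leftarrow>\<Gamma>. csc (- \<i>) o\<^sub>L integral {0..1} (op_integrand F \<gamma>))" for \<Gamma>
  proof -
    \<comment> \<open>The factor \<open>- J\<close> in \<open>ds_J\<close> supplies the missing
      division by the imaginary unit.\<close>
    have "1 / (2 * pi * \<i>) = (1 / (2 * pi)) *\<^sub>R (- \<i>)" by (simp add: scaleR_conv_of_real field_simps)
    then have "riesz \<Gamma> = (1 / (2 * pi)) *\<^sub>R (csc (- \<i>) o\<^sub>L op_integral F \<Gamma>)"
      unfolding riesz_def F_def by (simp only: csc_scaleR blinfun_compose_simps)
    also have "csc (- \<i>) o\<^sub>L op_integral F \<Gamma> = (\<Sum>\<gamma>\<leftarrow>\<Gamma>. csc (- \<i>) o\<^sub>L integral {0..1} (op_integrand F \<gamma>))"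
      unfolding op_integral_def by (induction \<Gamma>) (simp_all add: blinfun_compose_simps)
    finally show ?thesis .
  qed
  have P_L: "(1 / (2 * pi)) *\<^sub>R qpath_integral J L \<Gamma>2 = riesz \<Gamma>2"
    unfolding riesz_sum qpath_integral_def using integral_unique[OF L_int] by (simp cong: map_cong)
  have P_R: "(1 / (2 * pi)) *\<^sub>R qpath_integral J R \<Gamma>1 = riesz \<Gamma>1"
    unfolding riesz_sum qpath_integral_def using integral_unique[OF R_int] by (simp cong: map_cong)
  have "qpath_integrable J L \<Gamma>2" "qpath_integrable J R \<Gamma>1"
    unfolding qpath_integrable_def using L_int R_int by (blast intro: has_integral_integrable)+
  with P_L P_R riesz_21 idem commT show ?thesis
    unfolding Let_def T_def[symmetric] L_def[symmetric] R_def[symmetric] by simp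
qed

end
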